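(* Let $d\ge0$ be an integer and let $u$ be an element of the free group $\langle z_1,\dots,z_d\mid\ \rangle$. Then the group $S=\langle x,y,z_1,\dots,z_d\mid[x,y]u\rangle$ is potent.
   Context: $[x,y]=xyx^{-1}y^{-1}$. A group $S$ is potent if, for each $s\in S-\{1\}$ and each integer $m\ge2$, there exists a homomorphism from $S$ to some finite group which sends $s$ to an element of order exactly $m$. *)

theory Defs
  imports "HOL-Algebra.Algebra"
begin

section \<open>Free groups as reduced words\<close>

text \<open>The letter \<open>(a, True)\<close> stands for the generator \<open>a\<close>, and \<open>(a, False)\<close> for its formal inverse.\<close>

type_synonym 'a word = "('a \<times> bool) list"

definition inv_letter :: "'a \<times> bool \<Rightarrow> 'a \<times> bool" where
  "inv_letter l = (fst l, \<not> snd l)"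

definition reduced :: "'a word \<Rightarrow> bool" where
  "reduced w \<longleftrightarrow> successively (\<lambda>k l. l \<noteq> inv_letter k) w"

fun rcons :: "'a \<times> bool \<Rightarrow> 'a word \<Rightarrow> 'a word" where
  "rcons k [] = [k]"
| "rcons k (l # w) = (if l = inv_letter k then w else k # l # w)"

definition reduce :: "'a word \<Rightarrow> 'a word" where
  "reduce w = foldr rcons w []"

definition free_group :: "'a set \<Rightarrow> 'a word monoid" where
  "free_group A = \<lparr>carrier = {w. reduced w \<and> fst ` set w \<subseteq> A},
                   monoid.mult = (\<lambda>v w. reduce (v @ w)), one = []\<rparr>"

definition free_gen :: "'a \<Rightarrow> 'a word" where
  "free_gen a = [(a, True)]"

lemma inv_letter_inv_letter [simp]: "inv_letter (inv_letter l) = l"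
  by (simp add: inv_letter_def)

lemma fst_inv_letter [simp]: "fst (inv_letter l) = fst l"
  by (simp add: inv_letter_def)

lemma reduced_Nil [simp]: "reduced []"
  by (simp add: reduced_def)

lemma reduced_Cons: "reduced (k # w) \<longleftrightarrow> reduced w \<and> (w = [] \<or> hd w \<noteq> inv_letter k)"
  by (cases w) (auto simp: reduced_def)

lemma reduced_rcons: "reduced w \<Longrightarrow> reduced (rcons k w)"
  by (cases w) (auto simp: reduced_Cons)

lemma reduced_foldr: "reduced w \<Longrightarrow> reduced (foldr rcons v w)"
  by (induction v) (auto intro: reduced_rcons)

lemma reduced_reduce: "reduced (reduce w)"
  by (simp add: reduce_def reduced_foldr)

lemma reduce_reduced: "reduced w \<Longrightarrow> reduce w = w"
proof (induction w)
  case (Cons k w)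
  then have "reduce w = w" by (simp add: reduced_Cons)
  with Cons.prems show ?case by (cases w) (auto simp: reduce_def reduced_Cons)
qed (simp add: reduce_def)

lemma set_rcons: "set (rcons k w) \<subseteq> insert k (set w)"
  by (cases w) auto

lemma set_reduce: "set (reduce w) \<subseteq> set w"
proof (induction w)
  case (Cons k w)
  then show ?case using set_rcons[of k "reduce w"] by (auto simp: reduce_def)
qed (simp add: reduce_def)

lemma rcons_inv: "reduced w \<Longrightarrow> rcons k (rcons (inv_letter k) w) = w"
  by (cases w rule: list.exhaust; cases "tl w") (auto simp: reduced_Cons)

lemma foldr_rcons: "reduced w \<Longrightarrow> foldr rcons (rcons k v) w = rcons k (foldr rcons v w)"
  by (cases v) (auto simp: rcons_inv reduced_foldr)

lemma foldr_reduce: "reduced w \<Longrightarrow> foldr rcons (reduce v) w = foldr rcons v w"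
  by (induction v) (auto simp: reduce_def foldr_rcons)

lemma reduce_append: "reduce (v @ w) = foldr rcons v (reduce w)"
  by (simp add: reduce_def)

lemma reduce_append_left: "reduce (reduce v @ w) = reduce (v @ w)"
  by (simp add: reduce_append foldr_reduce reduced_reduce)

lemma reduce_append_right: "reduce (v @ reduce w) = reduce (v @ w)"
  by (simp add: reduce_append reduce_reduced reduced_reduce)

lemma reduce_inv_append: "reduce (rev (map inv_letter w) @ w) = []"
proof (induction w)
  case (Cons k w)
  have "reduce (rev (map inv_letter (k # w)) @ k # w)
      = foldr rcons (rev (map inv_letter w)) (rcons (inv_letter k) (rcons (inv_letter (inv_letter k)) (reduce w)))"
    by (simp add: reduce_def)
  also have "\<dots> = foldr rcons (rev (map inv_letter w)) (reduce w)"
    by (simp only: rcons_inv reduced_reduce)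
  finally show ?case using Cons by (simp add: reduce_append)
qed (simp add: reduce_def)

lemma group_free_group: "group (free_group A)"
proof (rule groupI)
  fix v w assume "v \<in> carrier (free_group A)" "w \<in> carrier (free_group A)"
  then show "v \<otimes>\<^bsub>free_group A\<^esub> w \<in> carrier (free_group A)"
    using set_reduce[of "v @ w"] by (fastforce simp: free_group_def reduced_reduce)
next
  fix w assume w: "w \<in> carrier (free_group A)"
  let ?v = "reduce (rev (map inv_letter w))"
  have "?v \<in> carrier (free_group A)"
    using w set_reduce[of "rev (map inv_letter w)"]
    by (fastforce simp: free_group_def reduced_reduce)
  moreover have "?v \<otimes>\<^bsub>free_group A\<^esub> w = \<one>\<^bsub>free_group A\<^esub>"
    by (simp add: free_group_def reduce_append_left reduce_inv_append)
  ultimately show "\<exists>v\<in>carrier (free_group A). v \<otimes>\<^bsub>free_group A\<^esub> w = \<one>\<^bsub>free_group A\<^esub>"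
    by blast
qed (auto simp: free_group_def reduce_append_left reduce_append_right reduce_reduced)


section \<open>Group presentations\<close>

definition normal_closure :: "('a, 'b) monoid_scheme \<Rightarrow> 'a set \<Rightarrow> 'a set" where
  "normal_closure G R = \<Inter>{N. N \<lhd> G \<and> R \<subseteq> N}"

definition presented_group :: "'a set \<Rightarrow> 'a word set \<Rightarrow> 'a word set monoid" where
  "presented_group A R = free_group A Mod normal_closure (free_group A) R"

lemma (in group) normal_closure_normal:
  assumes "R \<subseteq> carrier G"
  shows "normal_closure G R \<lhd> G"
proof -
  let ?S = "{N. N \<lhd> G \<and> R \<subseteq> N}"
  have "carrier G \<lhd> G"
    by (auto simp: normal_inv_iff subgroup_self)
  with assms have ne: "?S \<noteq> {}" by blast
  have "subgroup (\<Inter>?S) G"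
    using ne by (intro subgroups_Inter) (auto simp: normal_imp_subgroup)
  then show ?thesis
    unfolding normal_closure_def normal_inv_iff by (auto simp: normal_inv_iff)
qed

lemma group_presented_group:
  assumes "R \<subseteq> carrier (free_group A)"
  shows "group (presented_group A R)"
  unfolding presented_group_def
  by (intro normal.factorgroup_is_group group.normal_closure_normal group_free_group assms)

definition commutator :: "('a, 'b) monoid_scheme \<Rightarrow> 'a \<Rightarrow> 'a \<Rightarrow> 'a" where
  "commutator G a b = a \<otimes>\<^bsub>G\<^esub> b \<otimes>\<^bsub>G\<^esub> inv\<^bsub>G\<^esub> a \<otimes>\<^bsub>G\<^esub> inv\<^bsub>G\<^esub> b"

datatype gen_xyz = Gen_x | Gen_y | Gen_z nat


section \<open>Potent groups\<close>

text \<open>HOL cannot quantify over the carrier type of the finite group. Carriers in \<^typ>\<open>nat\<close> lose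
  no generality, since every finite group is isomorphic to one of these; see \<open>potentI\<close>.\<close>

definition potent :: "('a, 'b) monoid_scheme \<Rightarrow> bool" where
  "potent S \<longleftrightarrow> group S \<and>
     (\<forall>s \<in> carrier S - {\<one>\<^bsub>S\<^esub>}. \<forall>m::nat. m \<ge> 2 \<longrightarrow>
        (\<exists>(H :: nat monoid) h. group H \<and> finite (carrier H) \<and> h \<in> hom S H \<and> group.ord H (h s) = m))"

lemma ord_iso:
  assumes "group G" "group H" "f \<in> iso G H" "x \<in> carrier G"
  shows "group.ord H (f x) = group.ord G x"
proof -
  interpret G: group G by fact
  interpret H: group H by fact
  interpret f: group_hom G H f
    using assms by (simp add: group_hom_def group_hom_axioms_def iso_def)
  have inj: "inj_on f (carrier G)"
    using assms(3) by (simp add: iso_def bij_betw_def)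
  have "f x [^]\<^bsub>H\<^esub> n = \<one>\<^bsub>H\<^esub> \<longleftrightarrow> x [^]\<^bsub>G\<^esub> n = \<one>\<^bsub>G\<^esub>" for n :: nat
    using inj_onD[OF inj, of "x [^]\<^bsub>G\<^esub> n" "\<one>\<^bsub>G\<^esub>"] assms(4)
    by (auto simp flip: f.hom_nat_pow)
  then show ?thesis
    using assms(4) by (simp add: H.ord_unique G.pow_eq_id)
qed

lemma potentI:
  fixes S :: "('a, 'b) monoid_scheme"
  assumes "group S"
    and "\<And>s (m::nat). s \<in> carrier S \<Longrightarrow> s \<noteq> \<one>\<^bsub>S\<^esub> \<Longrightarrow> m \<ge> 2 \<Longrightarrow>
      \<exists>(H :: 'c monoid) h. group H \<and> finite (carrier H) \<and> h \<in> hom S H \<and> group.ord H (h s) = m"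
  shows "potent S"
  unfolding potent_def
proof (intro conjI ballI allI impI)
  fix s and m :: nat
  assume s: "s \<in> carrier S - {\<one>\<^bsub>S\<^esub>}" and "m \<ge> 2"
  then obtain H :: "'c monoid" and h
    where H: "group H" "finite (carrier H)" and h: "h \<in> hom S H" "group.ord H (h s) = m"
    using assms(2) by blast
  interpret H: group H by fact
  obtain f :: "'c \<Rightarrow> nat" where f: "inj_on f (carrier H)"
    using finite_imp_inj_to_nat_seg[OF H(2)] by blast
  let ?K = "image_group f H"
  have K: "group ?K" and iso: "f \<in> iso H ?K"
    using H.inj_imp_image_group_is_group[OF f] inj_imp_image_group_iso[OF f] by auto
  have "finite (carrier ?K)"
    using H(2) by (simp add: image_group_carrier)
  moreover have "f \<circ> h \<in> hom S ?K"
    using h(1) iso by (auto simp: iso_def intro: hom_compose)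
  moreover have "group.ord ?K ((f \<circ> h) s) = m"
    using ord_iso[OF H(1) K iso, of "h s"] h s by (auto simp: hom_def)
  ultimately show "\<exists>(H :: nat monoid) h. group H \<and> finite (carrier H) \<and> h \<in> hom S H \<and> group.ord H (h s) = m"
    using K by blast
qed fact

end

theory Submission
  imports Defs
begin

text \<open>
  The relation \<open>[x, y] u = 1\<close> says \<open>x y x\<^sup>-\<^sup>1 = u\<^sup>-\<^sup>1 y\<close>, so \<open>S\<close> is the semidirect product of the free
  group \<open>K\<close> on \<open>y\<close> and the \<open>z\<^sub>j\<^sub>i = x\<^sup>i z\<^sub>j x\<^sup>-\<^sup>i\<close> with \<open>\<langle>x\<rangle>\<close>. An element outside \<open>K\<close> is dealt with in a
  finite cyclic group. For \<open>s \<in> K\<close>, reading the indices \<open>i\<close> modulo a large \<open>N\<close> keeps \<open>s\<close> nontrivial in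
  a free group of finite rank on which \<open>x\<close> still acts, so it suffices to find an invariant finite
  quotient in which \<open>s\<close> has order \<open>m\<close>.

  Let \<open>1 + P + \<dots>\<close> be the Magnus expansion of \<open>s\<close>, with \<open>P \<noteq> 0\<close> the homogeneous part of lowest degree
  \<open>n\<close>, and let \<open>C\<close> be the gcd of the coefficients of \<open>P\<close>. Modulo \<open>m C\<close> and degree greater than \<open>n\<close>, the
  powers of \<open>s\<close> expand to \<open>1 + k P\<close>, so \<open>s\<close> has order exactly \<open>m\<close>. A word whose truncated expansion is
  \<open>1\<close> becomes trivial under every substitution by units of the truncated power series ring, whence the
  invariance.
\<close>

section \<open>Evaluation of words\<close>

text \<open>Any list of letters can be evaluated, reduced or not, so that concatenated powers and
  relabelled words are handled as they stand.\<close>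

definition word_val :: "('b, 'c) monoid_scheme \<Rightarrow> ('a \<Rightarrow> 'b) \<Rightarrow> 'a word \<Rightarrow> 'b" where
  "word_val G \<sigma> w =
     foldr (\<lambda>l x. (if snd l then \<sigma> (fst l) else inv\<^bsub>G\<^esub> \<sigma> (fst l)) \<otimes>\<^bsub>G\<^esub> x) w \<one>\<^bsub>G\<^esub>"

lemma word_val_Nil [simp]: "word_val G \<sigma> [] = \<one>\<^bsub>G\<^esub>"
  by (simp add: word_val_def)

lemma word_val_Cons [simp]:
  "word_val G \<sigma> (l # w) = (if snd l then \<sigma> (fst l) else inv\<^bsub>G\<^esub> \<sigma> (fst l)) \<otimes>\<^bsub>G\<^esub> word_val G \<sigma> w"
  by (simp add: word_val_def)

lemma word_val_cong:
  "(\<And>a. a \<in> fst ` set w \<Longrightarrow> \<sigma> a = \<tau> a) \<Longrightarrow> word_val G \<sigma> w = word_val G \<tau> w"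
  by (induction w) auto

lemma word_val_map: "word_val G \<sigma> (map (apfst f) w) = word_val G (\<sigma> \<circ> f) w"
  by (induction w) auto

context group
begin

lemma word_val_closed:
  "\<sigma> \<in> A \<rightarrow> carrier G \<Longrightarrow> fst ` set w \<subseteq> A \<Longrightarrow> word_val G \<sigma> w \<in> carrier G"
  by (induction w) (auto simp: Pi_iff)

lemma word_val_append:
  assumes "\<sigma> \<in> A \<rightarrow> carrier G" "fst ` set v \<subseteq> A" "fst ` set w \<subseteq> A"
  shows "word_val G \<sigma> (v @ w) = word_val G \<sigma> v \<otimes> word_val G \<sigma> w"
  using assms(2)
proof (induction v)
  case (Cons l v)
  then show ?case
    using assms word_val_closed[of \<sigma> A v] word_val_closed[of \<sigma> A w]
    by (auto simp: Pi_iff m_assoc)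
qed (use word_val_closed[OF assms(1,3)] in simp)

lemma word_val_rcons:
  assumes "\<sigma> \<in> A \<rightarrow> carrier G" "fst ` set (k # w) \<subseteq> A"
  shows "word_val G \<sigma> (rcons k w) = word_val G \<sigma> (k # w)"
proof (cases "w \<noteq> [] \<and> hd w = inv_letter k")
  case True
  then obtain v where w: "w = inv_letter k # v" by (metis list.collapse)
  have "\<sigma> (fst k) \<in> carrier G" "word_val G \<sigma> v \<in> carrier G"
    using assms word_val_closed[of \<sigma> A v] by (auto simp: w)
  then show ?thesis
    by (auto simp: w inv_letter_def simp flip: m_assoc)
qed (cases w; auto)

lemma word_val_reduce:
  assumes "\<sigma> \<in> A \<rightarrow> carrier G" "fst ` set w \<subseteq> A"
  shows "word_val G \<sigma> (reduce w) = word_val G \<sigma> w"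
  using assms(2)
proof (induction w)
  case (Cons k w)
  then have "fst ` set (k # reduce w) \<subseteq> A"
    using set_reduce[of w] by auto
  from word_val_rcons[OF assms(1) this] Cons show ?case
    by (simp add: reduce_def)
qed (simp add: reduce_def)

lemma word_val_hom:
  assumes "\<sigma> \<in> A \<rightarrow> carrier G"
  shows "word_val G \<sigma> \<in> hom (free_group A) G"
proof (rule homI)
  fix v w assume "v \<in> carrier (free_group A)" "w \<in> carrier (free_group A)"
  then have "fst ` set v \<subseteq> A" "fst ` set w \<subseteq> A" by (auto simp: free_group_def)
  then show "word_val G \<sigma> (v \<otimes>\<^bsub>free_group A\<^esub> w) = word_val G \<sigma> v \<otimes> word_val G \<sigma> w"
    by (simp add: free_group_def word_val_reduce[OF assms] word_val_append[OF assms] image_Un)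
qed (auto simp: free_group_def intro: word_val_closed[OF assms])

text \<open>Turns a power of a word value into the value of a single unreduced word, so that results
  about trivial word values apply to powers.\<close>

lemma word_val_replicate:
  assumes "\<sigma> \<in> A \<rightarrow> carrier G" "fst ` set w \<subseteq> A"
  shows "word_val G \<sigma> (concat (replicate k w)) = word_val G \<sigma> w [^] k"
proof (induction k)
  case (Suc k)
  have "word_val G \<sigma> (concat (replicate (Suc k) w))
      = word_val G \<sigma> w \<otimes> word_val G \<sigma> (concat (replicate k w))"
    using assms(2) by (simp, intro word_val_append[OF assms(1)]) force+
  also have "\<dots> = word_val G \<sigma> w [^] Suc k"
    using Suc word_val_closed[OF assms] by (simp only: nat_pow_Suc2)
  finally show ?case .
qed simp

lemma ord_eqI:
  assumes "x \<in> carrier G" "\<And>k::nat. x [^] k = \<one> \<longleftrightarrow> m dvd k"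
  shows "ord x = m"
  using assms pow_eq_id[OF assms(1)] by (metis dvd_antisym dvd_refl)

end

lemma (in group_hom) hom_word_val:
  assumes "\<sigma> \<in> A \<rightarrow> carrier G" "fst ` set w \<subseteq> A"
  shows "h (word_val G \<sigma> w) = word_val H (h \<circ> \<sigma>) w"
  using assms(2)
proof (induction w)
  case (Cons l w)
  then have "\<sigma> (fst l) \<in> carrier G" "word_val G \<sigma> w \<in> carrier G"
    using assms(1) G.word_val_closed[OF assms(1), of w] by auto
  with Cons show ?case by auto
qed simp

section \<open>Noncommutative power series with integer coefficients\<close>

text \<open>The Cauchy product over all factorisations of the word. The recursion passes to the left
  derivative \<open>\<lambda>t. f (a # t)\<close>, which avoids an explicit sum over cut points and
  lets the ring laws be proved by induction on the word.\<close>

fun conv :: "('a list \<Rightarrow> int) \<Rightarrow> ('a list \<Rightarrow> int) \<Rightarrow> 'a list \<Rightarrow> int" where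
  "conv f g [] = f [] * g []"
| "conv f g (a # w) = f [] * g (a # w) + conv (\<lambda>t. f (a # t)) g w"

lemma conv_add_left: "conv (\<lambda>t. f t + g t) h w = conv f h w + conv g h w"
  by (induction w arbitrary: f g) (auto simp: algebra_simps)

lemma conv_add_right: "conv h (\<lambda>t. f t + g t) w = conv h f w + conv h g w"
  by (induction w arbitrary: h) (auto simp: algebra_simps)

lemma conv_scale_left: "conv (\<lambda>t. c * f t) g w = c * conv f g w"
  by (induction w arbitrary: f) (auto simp: algebra_simps)

lemma conv_zero_left: "conv (\<lambda>t. 0) g w = 0"
  by (induction w) auto

lemma conv_assoc: "conv (conv f g) h w = conv f (conv g h) w"
  by (induction w arbitrary: f) (auto simp: conv_add_left conv_scale_left algebra_simps)

lemma conv_one_left: "conv (\<lambda>t. if t = [] then 1 else 0) g w = g w"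
  by (cases w) (auto simp: conv_zero_left)

lemma conv_one_right: "conv f (\<lambda>t. if t = [] then 1 else 0) w = f w"
  by (induction w arbitrary: f) auto

typedef 'a ncseries = "UNIV :: ('a list \<Rightarrow> int) set"
  morphisms coeff Abs_ncseries
  by simp

setup_lifting type_definition_ncseries

instantiation ncseries :: (type) ring_1
begin

lift_definition zero_ncseries :: "'a ncseries" is "\<lambda>_. 0" .
lift_definition one_ncseries :: "'a ncseries" is "\<lambda>t. if t = [] then 1 else 0" .
lift_definition plus_ncseries :: "'a ncseries \<Rightarrow> 'a ncseries \<Rightarrow> 'a ncseries"
  is "\<lambda>f g t. f t + g t" .
lift_definition minus_ncseries :: "'a ncseries \<Rightarrow> 'a ncseries \<Rightarrow> 'a ncseries"
  is "\<lambda>f g t. f t - g t" .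
lift_definition uminus_ncseries :: "'a ncseries \<Rightarrow> 'a ncseries" is "\<lambda>f t. - f t" .
lift_definition times_ncseries :: "'a ncseries \<Rightarrow> 'a ncseries \<Rightarrow> 'a ncseries" is conv .

instance
proof
  fix a b c :: "'a ncseries"
  show "a * b * c = a * (b * c)" by transfer (auto simp: conv_assoc)
  show "1 * a = a" by transfer (auto simp: conv_one_left)
  show "a * 1 = a" by transfer (auto simp: conv_one_right)
  show "(a + b) * c = a * c + b * c" by transfer (auto simp: conv_add_left)
  show "a * (b + c) = a * b + a * c" by transfer (auto simp: conv_add_right)
  show "(0 :: 'a ncseries) \<noteq> 1" by transfer (metis zero_neq_one)
qed (transfer; auto)+

end

lemmas coeff_simps [simp] =
  zero_ncseries.rep_eq one_ncseries.rep_eq plus_ncseries.rep_eq minus_ncseries.rep_eq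
  uminus_ncseries.rep_eq

lemma ncseries_eqI: "(\<And>w. coeff f w = coeff g w) \<Longrightarrow> f = g"
  by (simp add: coeff_inject[symmetric] fun_eq_iff)

lemma coeff_mult_Nil [simp]: "coeff (f * g) [] = coeff f [] * coeff g []"
  by (simp add: times_ncseries.rep_eq)

lemma coeff_sum: "coeff (sum f A) w = (\<Sum>x\<in>A. coeff (f x) w)"
  by (induction A rule: infinite_finite_induct) auto

lemma coeff_of_nat: "coeff (of_nat n) w = (if w = [] then int n else 0)"
  by (induction n) auto

lemma coeff_of_int: "coeff (of_int c) w = (if w = [] then c else 0)"
  by (cases c rule: int_diff_cases) (auto simp: coeff_of_nat)

lemma coeff_of_int_mult [simp]: "coeff (of_int c * f) w = c * coeff f w"
proof -
  have "conv (\<lambda>t. if t = [] then c else 0) g w = c * g w" for g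
    by (cases w) (auto simp: conv_zero_left)
  moreover have "coeff (of_int c) = (\<lambda>t::'a list. if t = [] then c else 0)"
    by (auto simp: coeff_of_int)
  ultimately show ?thesis by (simp add: times_ncseries.rep_eq)
qed

section \<open>Variables and truncation ideals\<close>

lift_definition nc_var :: "'a \<Rightarrow> 'a ncseries" is "\<lambda>a t. if t = [a] then 1 else 0" .

lemma coeff_var_mult:
  "coeff (nc_var a * f) w = (case w of [] \<Rightarrow> 0 | b # t \<Rightarrow> if b = a then coeff f t else 0)"
proof (transfer, goal_cases)
  case (1 a f w)
  have "conv (\<lambda>t. if b # t = [a] then 1 else 0) f t = (if b = a then f t else 0)" for b t
    using conv_one_left[of f t] by (auto simp: conv_zero_left)
  then show ?case by (cases w) auto
qed

lemma coeff_nc_var_Nil [simp]: "coeff (nc_var a) [] = 0"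
  by transfer simp

text \<open>For \<open>M = 0\<close> this is the set of series without terms of degree at most \<open>n\<close> over \<open>A\<close>.\<close>

definition nc_ideal :: "'a set \<Rightarrow> nat \<Rightarrow> int \<Rightarrow> 'a ncseries set" where
  "nc_ideal A n M = {f. \<forall>w\<in>lists A. length w \<le> n \<longrightarrow> M dvd coeff f w}"

lemma nc_ideal_zero [simp]: "0 \<in> nc_ideal A n M"
  by (simp add: nc_ideal_def)

lemma nc_ideal_add: "f \<in> nc_ideal A n M \<Longrightarrow> g \<in> nc_ideal A n M \<Longrightarrow> f + g \<in> nc_ideal A n M"
  by (simp add: nc_ideal_def)

lemma nc_ideal_uminus: "f \<in> nc_ideal A n M \<Longrightarrow> - f \<in> nc_ideal A n M"
  by (simp add: nc_ideal_def)

lemma nc_ideal_diff: "f \<in> nc_ideal A n M \<Longrightarrow> g \<in> nc_ideal A n M \<Longrightarrow> f - g \<in> nc_ideal A n M"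
  by (simp add: nc_ideal_def)

lemma nc_ideal_sum:
  "(\<And>x. x \<in> B \<Longrightarrow> f x \<in> nc_ideal A n M) \<Longrightarrow> sum f B \<in> nc_ideal A n M"
  by (induction B rule: infinite_finite_induct) (auto intro: nc_ideal_add)

lemma nc_ideal_of_int_mult: "f \<in> nc_ideal A n M \<Longrightarrow> of_int c * f \<in> nc_ideal A n M"
  by (simp add: nc_ideal_def)

text \<open>The right factor enters the coefficient of \<open>w\<close> only through suffixes of
  \<open>w\<close>, which are again words over \<open>A\<close> of length at most
  \<open>n\<close>.\<close>

lemma nc_ideal_mult_left:
  assumes "f \<in> nc_ideal A n M"
  shows "g * f \<in> nc_ideal A n M"
proof -
  have *: "M dvd conv g f w"
    if "\<forall>w\<in>lists A. length w \<le> n \<longrightarrow> M dvd f w" "w \<in> lists A" "length w \<le> n" for f g w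
    using that(2,3)
  proof (induction w arbitrary: g)
    case Nil
    then show ?case using that(1)[rule_format, of "[]"] by simp
  next
    case (Cons a w)
    then have "a # w \<in> lists A" by simp
    with that(1) Cons.prems have "M dvd f (a # w)" by blast
    with Cons show ?case by simp
  qed
  have "\<forall>w\<in>lists A. length w \<le> n \<longrightarrow> M dvd coeff f w"
    using assms by (simp add: nc_ideal_def)
  from *[OF this] show ?thesis
    by (simp add: nc_ideal_def times_ncseries.rep_eq)
qed

lemma nc_ideal_mult_right:
  assumes "f \<in> nc_ideal A n M"
  shows "f * g \<in> nc_ideal A n M"
proof -
  \<comment> \<open>The recursion replaces \<open>f\<close> by a left derivative, for which the
    hypothesis holds only up to degree one less. Hence \<open>n\<close> varies along with
    \<open>f\<close> in the induction.\<close>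
  have *: "M dvd conv f g w"
    if "\<forall>w\<in>lists A. length w \<le> n \<longrightarrow> M dvd f w" "w \<in> lists A" "length w \<le> n" for f g w n
    using that
  proof (induction w arbitrary: f n)
    case (Cons a w)
    from Cons.prems(3) obtain k where n: "n = Suc k" by (cases n) simp_all
    have V: "\<forall>t\<in>lists A. length t \<le> k \<longrightarrow> M dvd f (a # t)"
    proof (intro ballI impI)
      fix t assume "t \<in> lists A" "length t \<le> k"
      then show "M dvd f (a # t)"
        using Cons.prems(1)[rule_format, of "a # t"] Cons.prems(2) by (simp add: n)
    qed
    have "M dvd conv (\<lambda>t. f (a # t)) g w"
      using Cons.prems(2,3) by (intro Cons.IH[OF V]) (simp_all add: n)
    moreover have "M dvd f []" using Cons.prems(1)[rule_format, of "[]"] by simp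
    ultimately show ?case by simp
  next
    case Nil
    show ?case using Nil(1)[rule_format, of "[]"] by simp
  qed
  have "\<forall>w\<in>lists A. length w \<le> n \<longrightarrow> M dvd coeff f w"
    using assms by (simp add: nc_ideal_def)
  from *[OF this] show ?thesis
    by (simp add: nc_ideal_def times_ncseries.rep_eq)
qed

text \<open>Lowest degrees add: any factorisation of a word shorter than \<open>k + l\<close> has a
  prefix shorter than \<open>k\<close> or a suffix shorter than \<open>l\<close>.\<close>

lemma nc_ideal_degree_mult:
  assumes f: "\<forall>w\<in>lists A. length w < k \<longrightarrow> coeff f w = 0"
    and g: "\<forall>w\<in>lists A. length w < l \<longrightarrow> coeff g w = 0"
  shows "\<forall>w\<in>lists A. length w < k + l \<longrightarrow> coeff (f * g) w = 0"
proof -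
  have *: "conv f g w = 0"
    if "\<forall>w\<in>lists A. length w < k \<longrightarrow> f w = 0" "w \<in> lists A" "length w < k + l"
       "\<forall>w\<in>lists A. length w < l \<longrightarrow> g w = 0" for f g w k
    using that
  proof (induction w arbitrary: f k)
    case Nil
    show ?case
      using Nil(3) Nil(1)[rule_format, of "[]"] Nil(4)[rule_format, of "[]"] by (cases "k = 0") simp_all
  next
    case (Cons a w)
    \<comment> \<open>For \<open>k = 0\<close> the truncated subtraction makes this vacuous; the
      first summand of the recursion then vanishes through \<open>g\<close> instead of
      \<open>f\<close>.\<close>
    have V: "\<forall>t\<in>lists A. length t < k - 1 \<longrightarrow> f (a # t) = 0"
    proof (intro ballI impI)
      fix t assume "t \<in> lists A" "length t < k - 1"
      then show "f (a # t) = 0"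
        using Cons.prems(1)[rule_format, of "a # t"] Cons.prems(2) by simp
    qed
    have "conv (\<lambda>t. f (a # t)) g w = 0"
      using Cons.prems(2,3) by (intro Cons.IH[OF V _ _ Cons.prems(4)]) auto
    moreover have "f [] * g (a # w) = 0"
      using Cons.prems(1)[rule_format, of "[]"] Cons.prems(4)[rule_format, of "a # w"] Cons.prems(2,3)
      by (cases "k = 0") simp_all
    ultimately show ?case by simp
  qed
  from *[OF f _ _ g] show ?thesis
    by (simp add: times_ncseries.rep_eq)
qed

section \<open>The Magnus expansion\<close>

definition nc_units :: "'a ncseries monoid" where
  "nc_units = \<lparr>carrier = {f. coeff f [] = 1}, monoid.mult = (*), one = 1\<rparr>"

lemma nc_units_simps [simp]:
  "f \<in> carrier nc_units \<longleftrightarrow> coeff f [] = 1"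
  "f \<otimes>\<^bsub>nc_units\<^esub> g = f * g" "\<one>\<^bsub>nc_units\<^esub> = 1"
  by (auto simp: nc_units_def)

text \<open>The inverse is the geometric series in \<open>1 - f\<close>. That series has no constant
  term, so only finitely many of its powers contribute to a given coefficient.\<close>

lemma ncseries_left_inverse:
  assumes "coeff f [] = 1"
  obtains g where "coeff g [] = 1" "g * f = 1"
proof -
  define D where "D = 1 - f"
  define S where "S n = (\<Sum>i\<le>n. D ^ i)" for n
  have vanish: "\<forall>w\<in>lists UNIV. length w < n \<longrightarrow> coeff (D ^ n) w = 0" for n
  proof (induction n)
    case (Suc n)
    have "\<forall>w\<in>lists UNIV. length w < 1 \<longrightarrow> coeff D w = 0"
      using assms by (simp add: D_def)
    from nc_ideal_degree_mult[OF this Suc] show ?case by simp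
  qed simp
  have Sf: "S n * f = 1 - D ^ Suc n" for n
  proof (induction n)
    case (Suc n)
    have "S (Suc n) * f = S n * f + D ^ Suc n * (1 - D)"
      by (simp add: S_def D_def distrib_right)
    also have "\<dots> = 1 - D ^ Suc n * D"
      by (simp only: Suc right_diff_distrib) simp
    finally show ?case by (simp only: power_Suc2)
  qed (simp add: S_def D_def)
  \<comment> \<open>The infinite sum is formed coefficientwise: at \<open>w\<close> the partial sum
    up to \<open>length w\<close> already has its final value, because \<open>D ^ i\<close> has no
    terms of degree below \<open>i\<close>.\<close>
  define g where "g = Abs_ncseries (\<lambda>w. coeff (S (length w)) w)"
  have coeff_g: "coeff g w = coeff (S n) w" if "length w \<le> n" for w n
  proof -
    have "(\<Sum>i\<le>n. coeff (D ^ i) w) = (\<Sum>i\<le>length w. coeff (D ^ i) w)"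
      by (rule sum.mono_neutral_right) (use that vanish in auto)
    then show ?thesis by (simp add: g_def Abs_ncseries_inverse S_def coeff_sum)
  qed
  have "coeff (g * f) w = coeff 1 w" for w
  proof -
    have "g - S (length w) \<in> nc_ideal UNIV (length w) 0"
      by (auto simp: nc_ideal_def coeff_g)
    then have "(g - S (length w)) * f \<in> nc_ideal UNIV (length w) 0"
      by (rule nc_ideal_mult_right)
    then have "coeff (g * f) w = coeff (S (length w) * f) w"
      by (simp add: nc_ideal_def left_diff_distrib)
    also have "\<dots> = coeff 1 w"
      using vanish[of "Suc (length w)"] unfolding Sf minus_ncseries.rep_eq by simp
    finally show ?thesis .
  qed
  then have "g * f = 1" by (rule ncseries_eqI)
  moreover have "coeff g [] = 1" using coeff_g[of "[]" 0] by (simp add: S_def)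
  ultimately show thesis using that by blast
qed

lemma group_nc_units: "group nc_units"
proof (rule groupI)
  fix f :: "'a ncseries"
  assume "f \<in> carrier nc_units"
  then obtain g where "coeff g [] = 1" "g * f = 1"
    using ncseries_left_inverse[of f] by auto
  then show "\<exists>g\<in>carrier nc_units. g \<otimes>\<^bsub>nc_units\<^esub> f = \<one>\<^bsub>nc_units\<^esub>"
    by (auto intro!: bexI[of _ g])
qed (auto simp: mult.assoc)

interpretation nc_units: group nc_units
  by (rule group_nc_units)

lemma nc_units_pow [simp]: "f [^]\<^bsub>nc_units\<^esub> (k::nat) = f ^ k"
  by (induction k) (simp_all add: power_commutes)

definition magnus :: "'a word \<Rightarrow> 'a ncseries" where
  "magnus = word_val nc_units (\<lambda>a. 1 + nc_var a)"

lemma magnus_Nil [simp]: "magnus [] = 1"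
  by (simp add: magnus_def)

text \<open>For a negative letter the equation is multiplied out, so that the alternating series
  inverse to \<open>1 + nc_var a\<close> need not be expanded.\<close>

lemma magnus_Cons:
  "magnus ((a, True) # w) = (1 + nc_var a) * magnus w"
  "(1 + nc_var a) * magnus ((a, False) # w) = magnus w"
proof -
  show "magnus ((a, True) # w) = (1 + nc_var a) * magnus w"
    by (simp add: magnus_def)
  let ?i = "inv\<^bsub>nc_units\<^esub> (1 + nc_var a)"
  have "(1 + nc_var a) * ?i = 1"
    using nc_units.r_inv[of "1 + nc_var a"] by simp
  then show "(1 + nc_var a) * magnus ((a, False) # w) = magnus w"
    by (simp add: magnus_def flip: mult.assoc)
qed

lemma coeff_magnus_Nil [simp]: "coeff (magnus w) [] = 1"
  using nc_units.word_val_closed[of "\<lambda>a. 1 + nc_var a" UNIV w] by (simp add: magnus_def)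

text \<open>On words without repeated adjacent letters only the linear terms of
  \<^term>\<open>inv\<^bsub>nc_units\<^esub> (1 + nc_var a)\<close> contribute.\<close>

lemma coeff_magnus_Cons:
  assumes "distinct_adj t"
  shows "coeff (magnus (l # w)) t = coeff (magnus w) t +
     (case t of [] \<Rightarrow> 0 | b # t' \<Rightarrow>
        if b = fst l then (if snd l then 1 else - 1) * coeff (magnus w) t' else 0)"
proof (cases l)
  case (Pair a s)
  show ?thesis
  proof (cases s)
    case True
    then show ?thesis
      by (cases t) (simp_all add: Pair magnus_Cons(1) distrib_right coeff_var_mult)
  next
    case False
    have eq: "coeff (magnus w) t = coeff (magnus (l # w)) t +
       (case t of [] \<Rightarrow> 0 | b # t' \<Rightarrow> if b = a then coeff (magnus (l # w)) t' else 0)" for t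
    proof -
      have "coeff (magnus w) t = coeff ((1 + nc_var a) * magnus (l # w)) t"
        by (simp only: magnus_Cons(2) Pair False)
      then show ?thesis by (simp only: distrib_right mult_1 plus_ncseries.rep_eq coeff_var_mult)
    qed
    show ?thesis
    proof (cases t)
      case (Cons b t')
      \<comment> \<open>Since \<open>t'\<close> does not start with \<open>b\<close>, prefixing
        \<open>l\<close> leaves its coefficient unchanged, and the recursion given by
        \<open>eq\<close> stops after one step.\<close>
      have "t' = [] \<or> hd t' \<noteq> b" using assms Cons by (cases t') auto
      then have "b = a \<Longrightarrow> coeff (magnus w) t' = coeff (magnus (l # w)) t'"
        using eq[of t'] by (cases t') auto
      with eq[of t] show ?thesis
        by (cases "b = a") (simp_all add: Pair False Cons)
    qed simp
  qed
qed

text \<open>The witness \<open>T\<close> is the sequence of the letters of the syllables of \<open>w\<close>; its coefficient is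
  the product of their exponents. The last conjunct is what makes the induction go through.\<close>

lemma magnus_leading:
  assumes "w \<noteq> []" "reduced w"
  shows "\<exists>T e. T \<noteq> [] \<and> distinct_adj T \<and> set T \<subseteq> fst ` set w \<and> hd T = fst (hd w) \<and>
     0 < e \<and> coeff (magnus w) T = (if snd (hd w) then 1 else - 1) * e * coeff (magnus w) (tl T) \<and>
     coeff (magnus w) (tl T) \<noteq> 0 \<and>
     (\<forall>t. distinct_adj t \<longrightarrow> length T < length t \<or> length T = length t \<and> hd t \<noteq> hd T \<longrightarrow>
       coeff (magnus w) t = 0)"
  using assms
proof (induction w rule: list_nonempty_induct)
  case (single l)
  have "coeff (magnus [l]) t = 0"
    if "distinct_adj t" "1 < length t \<or> 1 = length t \<and> hd t \<noteq> fst l" for t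
    unfolding coeff_magnus_Cons[OF that(1)] using that(2) by (cases t) auto
  then show ?case
    by (intro exI[of _ "[fst l]"] exI[of _ 1]) (auto simp: coeff_magnus_Cons)
next
  case (cons l w)
  define s where "s = (if snd l then 1 else - 1 :: int)"
  have "reduced w" and red: "hd w \<noteq> inv_letter l"
    using cons.prems cons.hyps by (auto simp: reduced_Cons)
  from cons.IH[OF this(1)] obtain T e where T: "T \<noteq> []" "distinct_adj T" "set T \<subseteq> fst ` set w" "hd T = fst (hd w)"
    and e: "0 < e" "coeff (magnus w) T = (if snd (hd w) then 1 else - 1) * e * coeff (magnus w) (tl T)"
    and q: "coeff (magnus w) (tl T) \<noteq> 0"
    and V: "\<forall>t. distinct_adj t \<longrightarrow> length T < length t \<or> length T = length t \<and> hd t \<noteq> hd T \<longrightarrow>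
       coeff (magnus w) t = 0"
    by (elim exE conjE) (rule that)
  note vanish = V[rule_format]
  obtain b T' where T': "T = b # T'" using T(1) by (cases T) auto
  have step: "coeff (magnus (l # w)) t = coeff (magnus w) t +
     (case t of [] \<Rightarrow> 0 | c # t' \<Rightarrow> if c = fst l then s * coeff (magnus w) t' else 0)"
    if "distinct_adj t" for t
    unfolding s_def by (rule coeff_magnus_Cons[OF that])
  have adjT': "distinct_adj T'" and hdT': "T' = [] \<or> hd T' \<noteq> b"
    using T(2) by (auto simp: T' distinct_adj_Cons)
  show ?case
  proof (cases "fst l = b")
    case True
    \<comment> \<open>As the word is reduced, \<open>l\<close> prolongs the first syllable with the
      same sign: \<open>T\<close> is kept and \<open>e\<close> grows to \<open>e + 1\<close>, so no
      cancellation can occur.\<close>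
    then have same: "snd (hd w) = snd l"
      using red T(4) by (auto simp: T' inv_letter_def prod_eq_iff)
    have q': "coeff (magnus (l # w)) T' = coeff (magnus w) T'"
      using step[OF adjT'] hdT' True by (cases T') auto
    have "coeff (magnus (l # w)) T = coeff (magnus w) T + s * coeff (magnus w) T'"
      using step[OF T(2)] True by (simp add: T')
    then have "coeff (magnus (l # w)) T = s * (e + 1) * coeff (magnus (l # w)) T'"
      using e(2) same by (simp add: T' q' s_def algebra_simps split: if_splits)
    moreover have "coeff (magnus (l # w)) t = 0"
      if t: "distinct_adj t" "length T < length t \<or> length T = length t \<and> hd t \<noteq> hd T" for t
    proof (cases t)
      case (Cons c t')
      have t': "distinct_adj t'" "t' = [] \<or> hd t' \<noteq> c"
        using t(1) by (auto simp: Cons distinct_adj_Cons)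
      \<comment> \<open>Adjacent letters of \<open>t\<close> differ, so \<open>t'\<close> does not
        start with \<open>b\<close>. If dropping \<open>c\<close> makes \<open>t'\<close> only as
        long as \<open>T\<close>, it still differs from \<open>T\<close> in its first
        letter.\<close>
      have "coeff (magnus w) t' = 0" if "c = b"
      proof (rule vanish[OF t'(1)])
        have "t' \<noteq> []" using t(2) that by (auto simp: T' Cons)
        then show "length T < length t' \<or> length T = length t' \<and> hd t' \<noteq> hd T"
          using t(2) t'(2) that by (auto simp: T' Cons)
      qed
      then show ?thesis
        using step[OF t(1)] vanish[OF t] True by (simp add: Cons)
    qed (use t T' in simp)
    ultimately show ?thesis
      using T e(1) q q' True
      by (intro exI[of _ T] exI[of _ "e + 1"] conjI allI impI) (auto simp: T' s_def)
  next
    case False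
    \<comment> \<open>A new syllable begins: the witness becomes \<open>fst l # T\<close> with
      exponent 1, and the old witness is its tail.\<close>
    have adj: "distinct_adj (fst l # T)"
      using T(2) False by (simp add: T')
    have q': "coeff (magnus (l # w)) T = coeff (magnus w) T"
      using step[OF T(2)] False by (simp add: T')
    have "coeff (magnus (l # w)) (fst l # T) = s * coeff (magnus (l # w)) T"
      using step[OF adj] vanish[OF adj] by (simp add: q')
    moreover have "coeff (magnus (l # w)) T \<noteq> 0"
      using e q q' by auto
    moreover have "coeff (magnus (l # w)) t = 0"
      if t: "distinct_adj t"
        "length (fst l # T) < length t \<or> length (fst l # T) = length t \<and> hd t \<noteq> fst l" for t
    proof (cases t)
      case (Cons c t')
      have "distinct_adj t'" using t(1) by (auto simp: Cons distinct_adj_Cons)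
      then have "coeff (magnus w) t' = 0" if "c = fst l"
        by (rule vanish) (use t(2) that Cons in auto)
      moreover have "coeff (magnus w) t = 0"
        by (rule vanish[OF t(1)]) (use t(2) in auto)
      ultimately show ?thesis
        using step[OF t(1)] by (simp add: Cons)
    qed (use t in simp)
    ultimately show ?thesis
      using T(3) adj
      by (intro exI[of _ "fst l # T"] exI[of _ 1] conjI allI impI) (auto simp: s_def)
  qed
qed

text \<open>Magnus' theorem that the free group embeds in the units. Keeping \<open>t\<close> within
  the letters of \<open>w\<close> allows a finite alphabet later.\<close>

lemma magnus_faithful:
  assumes "w \<noteq> []" "reduced w"
  obtains t where "t \<noteq> []" "set t \<subseteq> fst ` set w" "coeff (magnus w) t \<noteq> 0"
proof -
  from magnus_leading[OF assms] obtain T e where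
    "T \<noteq> []" "set T \<subseteq> fst ` set w" "0 < e" "coeff (magnus w) (tl T) \<noteq> 0"
    "coeff (magnus w) T = (if snd (hd w) then 1 else - 1) * e * coeff (magnus w) (tl T)"
    by (elim exE conjE) (rule that)
  then show thesis by (intro that[of T]) auto
qed

text \<open>Substitutes \<open>p a - 1\<close> for the variable of \<open>a\<close>. The cut at
  degree \<open>n\<close> and the finite alphabet make this a finite sum; when each
  \<open>p a\<close> has constant term 1, the monomials left out only contribute in degrees greater
  than \<open>n\<close>.\<close>

definition nc_subst :: "'a set \<Rightarrow> nat \<Rightarrow> ('a \<Rightarrow> 'a ncseries) \<Rightarrow> 'a ncseries \<Rightarrow> 'a ncseries" where
  "nc_subst A n p f =
     (\<Sum>t | set t \<subseteq> A \<and> length t \<le> n. of_int (coeff f t) * prod_list (map (\<lambda>a. p a - 1) t))"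

lemma coeff_prod_list_vanish:
  assumes "p \<in> A \<rightarrow> carrier nc_units" "set t \<subseteq> A"
  shows "\<forall>w\<in>lists B. length w < length t \<longrightarrow> coeff (prod_list (map (\<lambda>a. p a - 1) t)) w = 0"
  using assms(2)
proof (induction t)
  case (Cons a t)
  have "coeff (p a) [] = 1" using assms(1) Cons.prems by (auto simp: Pi_iff)
  then have "\<forall>w\<in>lists B. length w < 1 \<longrightarrow> coeff (p a - 1) w = 0" by simp
  from nc_ideal_degree_mult[OF this Cons.IH] Cons.prems show ?case by simp
qed simp

text \<open>The two sides differ by monomials \<open>a # t\<close> with \<open>t\<close> of length
  exactly \<open>n\<close>. Their images are products of \<open>n + 1\<close> factors without
  constant term, hence vanish up to degree \<open>n\<close>, whatever \<open>M\<close> is.\<close>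

lemma nc_subst_var:
  assumes "finite A" "a \<in> A" and p: "p \<in> A \<rightarrow> carrier nc_units"
  shows "nc_subst A n p ((1 + nc_var a) * f) - p a * nc_subst A n p f \<in> nc_ideal A n M"
proof -
  let ?W = "{t. set t \<subseteq> A \<and> length t \<le> n}"
  let ?V = "{t. set t \<subseteq> A \<and> length t < n}"
  define D where "D = (\<lambda>t. prod_list (map (\<lambda>a. p a - 1) t))"
  have fin: "finite ?W" by (rule finite_lists_length_le[OF assms(1)])
  have VW: "?V \<subseteq> ?W" by auto
  have "(\<Sum>t\<in>?W. of_int (coeff (nc_var a * f) t) * D t)
      = (\<Sum>t\<in>(#) a ` ?V. of_int (coeff (nc_var a * f) t) * D t)"
  proof (rule sum.mono_neutral_right[OF fin])
    show "(#) a ` ?V \<subseteq> ?W" using assms(2) by auto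
    show "\<forall>t\<in>?W - (#) a ` ?V. of_int (coeff (nc_var a * f) t) * D t = 0"
      by (auto simp: coeff_var_mult split: list.splits)
  qed
  also have "\<dots> = (\<Sum>t\<in>?V. of_int (coeff f t) * D (a # t))"
    by (subst sum.reindex) (auto simp: coeff_var_mult)
  finally have L: "nc_subst A n p ((1 + nc_var a) * f) =
      nc_subst A n p f + (\<Sum>t\<in>?V. of_int (coeff f t) * D (a # t))"
    by (simp add: nc_subst_def distrib_right sum.distrib D_def)
  have "(p a - 1) * (of_int c * D t) = of_int c * D (a # t)" for c t
    by (simp add: D_def mult.assoc mult_of_int_commute[of c])
  then have "(p a - 1) * nc_subst A n p f = (\<Sum>t\<in>?W. of_int (coeff f t) * D (a # t))"
    by (simp add: nc_subst_def D_def sum_distrib_left)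
  then have R: "p a * nc_subst A n p f =
      nc_subst A n p f + (\<Sum>t\<in>?W. of_int (coeff f t) * D (a # t))"
    by (simp add: left_diff_distrib diff_eq_eq add.commute)
  have "(\<Sum>t\<in>?W - ?V. of_int (coeff f t) * D (a # t)) \<in> nc_ideal A n M"
  proof (intro nc_ideal_sum nc_ideal_of_int_mult)
    fix t assume "t \<in> ?W - ?V"
    then have "set (a # t) \<subseteq> A" "length (a # t) = Suc n" using assms(2) by auto
    with coeff_prod_list_vanish[OF p this(1), of A] show "D (a # t) \<in> nc_ideal A n M"
      by (auto simp: nc_ideal_def D_def)
  qed
  then show ?thesis
    unfolding L R using sum.subset_diff[OF VW fin, of "\<lambda>t. of_int (coeff f t) * D (a # t)"]
    by (simp add: nc_ideal_uminus flip: minus_add_distrib)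
qed

lemma nc_subst_one:
  assumes "finite A"
  shows "nc_subst A n p 1 = 1"
proof -
  let ?W = "{t. set t \<subseteq> A \<and> length t \<le> n}"
  have "finite ?W" by (rule finite_lists_length_le[OF assms])
  then have "nc_subst A n p 1 = (\<Sum>t\<in>{[]}. of_int (coeff 1 t) * prod_list (map (\<lambda>a. p a - 1) t))"
    unfolding nc_subst_def by (intro sum.mono_neutral_right) auto
  then show ?thesis by simp
qed

lemma word_val_nc_units:
  assumes "finite A" and p: "p \<in> A \<rightarrow> carrier nc_units" and "fst ` set w \<subseteq> A"
  shows "word_val nc_units p w - nc_subst A n p (magnus w) \<in> nc_ideal A n M"
  using assms(3)
proof (induction w)
  case Nil
  then show ?case by (simp add: nc_subst_one[OF assms(1)])
next
  case (Cons l w)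
  obtain a s where l: "l = (a, s)" by (cases l)
  have a: "a \<in> A" and w: "fst ` set w \<subseteq> A" using Cons.prems by (auto simp: l)
  let ?V = "word_val nc_units p w" and ?S = "nc_subst A n p"
  have IH: "?V - ?S (magnus w) \<in> nc_ideal A n M" by (rule Cons.IH[OF w])
  note var = nc_subst_var[OF assms(1) a p, of n _ M]
  show ?case
  proof (cases s)
    case True
    have "word_val nc_units p (l # w) - ?S (magnus (l # w)) =
        p a * (?V - ?S (magnus w)) - (?S ((1 + nc_var a) * magnus w) - p a * ?S (magnus w))"
      by (simp add: l True magnus_Cons(1) right_diff_distrib)
    then show ?thesis
      by (simp only: nc_ideal_diff nc_ideal_mult_left IH var)
  next
    case False
    let ?m = "magnus (l # w)" and ?i = "inv\<^bsub>nc_units\<^esub> p a"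
    have "p a \<in> carrier nc_units" using p a by auto
    from nc_units.l_inv[OF this] have i: "?i * p a = 1" by simp
    have m: "(1 + nc_var a) * ?m = magnus w" by (simp add: l False magnus_Cons(2))
    \<comment> \<open>For a negative letter \<open>var\<close> is applied to the longer word, and
      the resulting congruence is multiplied by the inverse of \<open>p a\<close>.\<close>
    have "?i * ((?V - ?S (magnus w)) + (?S ((1 + nc_var a) * ?m) - p a * ?S ?m))
        = ?i * ?V - (?i * p a) * ?S ?m"
      unfolding m by (simp add: right_diff_distrib mult.assoc)
    also have "\<dots> = word_val nc_units p (l # w) - ?S ?m"
      by (simp add: i l False)
    finally show ?thesis
      using nc_ideal_mult_left[OF nc_ideal_add[OF IH var[of ?m]], of ?i] by simp
  qed
qed


section \<open>Finite quotients of the group of units\<close>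

text \<open>The kernel of reading coefficients modulo \<open>M\<close> on words over
  \<open>A\<close> of length at most \<open>n\<close>. The quotient is the group of truncated series
  with constant term 1 over the integers modulo \<open>M\<close>.\<close>

definition nc_cong :: "'a set \<Rightarrow> nat \<Rightarrow> int \<Rightarrow> 'a ncseries set" where
  "nc_cong A n M = {f \<in> carrier nc_units. f - 1 \<in> nc_ideal A n M}"

lemma nc_units_inv:
  assumes "f \<in> carrier nc_units"
  shows "inv\<^bsub>nc_units\<^esub> f * f = 1" "f * inv\<^bsub>nc_units\<^esub> f = 1" "coeff (inv\<^bsub>nc_units\<^esub> f) [] = 1"
  using nc_units.l_inv[OF assms] nc_units.r_inv[OF assms] nc_units.inv_closed[OF assms] by simp_all

lemma nc_cong_normal: "nc_cong A n M \<lhd> nc_units"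
  unfolding nc_units.normal_inv_iff
proof (intro conjI ballI subgroup.intro)
  show "nc_cong A n M \<subseteq> carrier nc_units" by (auto simp: nc_cong_def)
  show "\<one>\<^bsub>nc_units\<^esub> \<in> nc_cong A n M" by (simp add: nc_cong_def)
next
  fix f g :: "'a ncseries"
  assume fg: "f \<in> nc_cong A n M" "g \<in> nc_cong A n M"
  have "f * (g - 1) + (f - 1) \<in> nc_ideal A n M"
    using fg by (intro nc_ideal_add nc_ideal_mult_left) (simp_all add: nc_cong_def)
  then show "f \<otimes>\<^bsub>nc_units\<^esub> g \<in> nc_cong A n M"
    using fg by (simp add: nc_cong_def right_diff_distrib)
next
  fix f :: "'a ncseries"
  assume f: "f \<in> nc_cong A n M"
  then have U: "f \<in> carrier nc_units" by (simp add: nc_cong_def)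
  let ?i = "inv\<^bsub>nc_units\<^esub> f"
  have "?i - 1 = - (?i * (f - 1))" by (simp add: right_diff_distrib nc_units_inv[OF U])
  with f show "?i \<in> nc_cong A n M"
    by (simp add: nc_cong_def nc_units_inv[OF U] nc_ideal_uminus nc_ideal_mult_left)
next
  fix x h :: "'a ncseries"
  assume x: "x \<in> carrier nc_units" and h: "h \<in> nc_cong A n M"
  let ?i = "inv\<^bsub>nc_units\<^esub> x"
  have "x * h * ?i - 1 = x * (h - 1) * ?i"
    by (simp add: right_diff_distrib left_diff_distrib nc_units_inv[OF x])
  with x h show "x \<otimes>\<^bsub>nc_units\<^esub> h \<otimes>\<^bsub>nc_units\<^esub> ?i \<in> nc_cong A n M"
    by (simp add: nc_cong_def nc_units_inv[OF x] nc_ideal_mult_left nc_ideal_mult_right)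
qed

text \<open>A coset is determined by the residues modulo \<open>M\<close> of the coefficients at the
  finitely many words over \<open>A\<close> of length at most \<open>n\<close>.\<close>

lemma finite_nc_units_Mod:
  assumes "finite A" "0 < M"
  shows "finite (carrier (nc_units Mod nc_cong A n M))"
proof -
  let ?N = "nc_cong A n M" and ?U = "carrier nc_units"
  let ?W = "{t. set t \<subseteq> A \<and> length t \<le> n}"
  define r where "r f = restrict (\<lambda>t. coeff f t mod M) ?W" for f
  have sub: "subgroup ?N nc_units" using nc_cong_normal normal_imp_subgroup by blast
  have "finite (?W \<rightarrow>\<^sub>E {0..<M})"
    by (intro finite_PiE finite_lists_length_le[OF assms(1)]) simp
  moreover have "r ` ?U \<subseteq> ?W \<rightarrow>\<^sub>E {0..<M}"
    using assms(2) unfolding r_def by (intro image_subsetI restrict_PiE_iff[THEN iffD2]) simp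
  ultimately have fin: "finite (r ` ?U)" by (rule finite_subset[rotated])
  have eq: "?N #>\<^bsub>nc_units\<^esub> f = ?N #>\<^bsub>nc_units\<^esub> g" if f: "f \<in> ?U" and g: "g \<in> ?U" and fg: "r f = r g" for f g
  proof -
    have "M dvd coeff (f - g) t" if "t \<in> lists A" "length t \<le> n" for t
    proof -
      have "r f t = r g t" using fg by simp
      with that show ?thesis by (simp add: r_def in_lists_conv_set subset_iff mod_eq_dvd_iff)
    qed
    then have "f - g \<in> nc_ideal A n M" by (simp add: nc_ideal_def)
    then have "(f - g) * inv\<^bsub>nc_units\<^esub> g \<in> nc_ideal A n M" by (rule nc_ideal_mult_right)
    moreover have "(f - g) * inv\<^bsub>nc_units\<^esub> g = f * inv\<^bsub>nc_units\<^esub> g - 1"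
      by (simp add: left_diff_distrib nc_units_inv[OF g])
    ultimately have "f * inv\<^bsub>nc_units\<^esub> g \<in> ?N"
      using f by (simp add: nc_cong_def nc_units_inv[OF g])
    moreover have "f = (f * inv\<^bsub>nc_units\<^esub> g) \<otimes>\<^bsub>nc_units\<^esub> g"
      by (simp add: mult.assoc nc_units_inv[OF g])
    ultimately have "f \<in> ?N #>\<^bsub>nc_units\<^esub> g" unfolding r_coset_def by blast
    then show ?thesis
      using nc_units.repr_independence[OF _ g sub] by simp
  qed
  \<comment> \<open>A representative is chosen for each table of residues, which exhibits the cosets
    as an image of the finite set of tables.\<close>
  define k where "k y = ?N #>\<^bsub>nc_units\<^esub> (SOME f. f \<in> ?U \<and> r f = y)" for y
  have "?N #>\<^bsub>nc_units\<^esub> f = k (r f)" if "f \<in> ?U" for f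
  proof -
    have "\<exists>g. g \<in> ?U \<and> r g = r f" using that by blast
    from someI_ex[OF this] show ?thesis
      unfolding k_def by (intro eq[OF that]) auto
  qed
  then have "carrier (nc_units Mod ?N) = k ` (r ` ?U)"
    by (force simp: carrier_FactGroup)
  with fin show ?thesis by simp
qed

text \<open>The last property says that the finite quotient of the free group in which \<open>v\<close> gets order
  \<open>m\<close> may be chosen invariant under endomorphisms.\<close>

theorem finite_group_with_word_order:
  fixes v :: "'a word" and m :: nat
  assumes A: "finite A" "fst ` set v \<subseteq> A" and v: "v \<noteq> []" "reduced v" and "0 < m"
  obtains G :: "'a ncseries set monoid" and g where
    "group G" "finite (carrier G)" "g \<in> A \<rightarrow> carrier G" "group.ord G (word_val G g v) = m"
    "\<forall>\<sigma>\<in>A \<rightarrow> carrier G. word_val G \<sigma> v [^]\<^bsub>G\<^esub> m = \<one>\<^bsub>G\<^esub>"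
proof -
  define P where "P = magnus v - 1"
  define n where "n = (LEAST n. \<exists>t. set t \<subseteq> A \<and> length t = n \<and> coeff P t \<noteq> 0)"
  obtain t0 where "t0 \<noteq> []" "set t0 \<subseteq> fst ` set v" "coeff (magnus v) t0 \<noteq> 0"
    using magnus_faithful[OF v] .
  then have ex: "\<exists>n t. set t \<subseteq> A \<and> length t = n \<and> coeff P t \<noteq> 0"
    using A(2) by (intro exI[of _ "length t0"] exI[of _ t0]) (auto simp: P_def)
  then obtain t1 where t1: "set t1 \<subseteq> A" "length t1 = n" "coeff P t1 \<noteq> 0"
    using LeastI_ex[OF ex] unfolding n_def by blast
  have low: "coeff P t = 0" if "set t \<subseteq> A" "length t < n" for t
    using that not_less_Least[of "length t" "\<lambda>n. \<exists>t. set t \<subseteq> A \<and> length t = n \<and> coeff P t \<noteq> 0"]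
    by (auto simp: n_def)
  have "n \<noteq> 0" using t1 by (auto simp: P_def)
  define W where "W = {t. set t \<subseteq> A \<and> length t = n}"
  define C where "C = Gcd (coeff P ` W)"
  define M where "M = int m * C"
  have t1W: "t1 \<in> W" using t1 by (simp add: W_def)
  have "C \<noteq> 0" using t1(3) t1W by (auto simp: C_def)
  moreover have "0 \<le> C" unfolding C_def by (rule Gcd_int_greater_eq_0)
  ultimately have "0 < C" by simp
  with \<open>0 < m\<close> have "0 < M" by (simp add: M_def)
  have lowP: "\<forall>t\<in>lists A. length t < n \<longrightarrow> coeff P t = 0"
    using low by (simp add: in_lists_conv_set subset_iff)
  \<comment> \<open>All terms of the square have degree at least \<open>2 * n\<close>, which exceeds
    \<open>n\<close> because \<open>n\<close> is positive. Hence the binomial expansion of a power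
    of \<open>1 + P\<close> stops after the linear term.\<close>
  have PP: "P * P \<in> nc_ideal A n M"
    using nc_ideal_degree_mult[OF lowP lowP] \<open>n \<noteq> 0\<close> by (simp add: nc_ideal_def)
  have pow: "magnus v ^ k - 1 - of_int (int k) * P \<in> nc_ideal A n M" for k
  proof (induction k)
    case (Suc k)
    define c where "c = (of_int (int k) :: 'a ncseries)"
    have "magnus v * (c * P) = c * magnus v * P"
      by (simp only: c_def mult_of_int_commute mult.assoc)
    also have "\<dots> = c * P + c * (P * P)"
      by (simp add: P_def algebra_simps)
    finally have "magnus v ^ Suc k - 1 - (c + 1) * P =
        magnus v * (magnus v ^ k - 1 - c * P) + c * (P * P)"
      by (simp add: right_diff_distrib distrib_right P_def)
    then have "magnus v ^ Suc k - 1 - of_int (int (Suc k)) * P =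
        magnus v * (magnus v ^ k - 1 - of_int (int k) * P) + of_int (int k) * (P * P)"
      by (simp add: c_def add.commute)
    with Suc show ?case
      by (simp only: nc_ideal_add nc_ideal_mult_left nc_ideal_of_int_mult PP)
  qed simp
  have key: "magnus v ^ k - 1 \<in> nc_ideal A n M \<longleftrightarrow> m dvd k" for k
  proof -
    have "magnus v ^ k - 1 \<in> nc_ideal A n M \<longleftrightarrow> of_int (int k) * P \<in> nc_ideal A n M"
    proof
      assume "magnus v ^ k - 1 \<in> nc_ideal A n M"
      from nc_ideal_diff[OF this pow[of k]] show "of_int (int k) * P \<in> nc_ideal A n M" by simp
    next
      assume "of_int (int k) * P \<in> nc_ideal A n M"
      from nc_ideal_add[OF pow[of k] this] show "magnus v ^ k - 1 \<in> nc_ideal A n M" by simp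
    qed
    also have "\<dots> \<longleftrightarrow> (\<forall>t\<in>W. M dvd int k * coeff P t)"
    proof
      assume "of_int (int k) * P \<in> nc_ideal A n M"
      then show "\<forall>t\<in>W. M dvd int k * coeff P t"
        unfolding nc_ideal_def mem_Collect_eq coeff_of_int_mult W_def lists_eq_set by simp
    next
      assume *: "\<forall>t\<in>W. M dvd int k * coeff P t"
      have "M dvd int k * coeff P t" if "set t \<subseteq> A" "length t \<le> n" for t
        using that * low[of t] by (cases "length t = n") (simp_all add: W_def)
      then show "of_int (int k) * P \<in> nc_ideal A n M"
        unfolding nc_ideal_def mem_Collect_eq coeff_of_int_mult lists_eq_set by simp
    qed
    also have "\<dots> \<longleftrightarrow> m dvd k"
    proof
      assume "\<forall>t\<in>W. M dvd int k * coeff P t"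
      \<comment> \<open>The gcd of the numbers \<open>k * coeff P t\<close> is \<open>k * C\<close>,
        so the condition becomes divisibility of \<open>k * C\<close> by
        \<open>m * C\<close>.\<close>
      then have "M dvd Gcd ((*) (int k) ` coeff P ` W)" by (intro Gcd_greatest) auto
      then have "int m * C dvd int k * C" by (simp add: Gcd_mult C_def[symmetric] M_def)
      then show "m dvd k" using \<open>C \<noteq> 0\<close> by simp
    next
      assume "m dvd k"
      then have "int m dvd int k" by simp
      moreover have "C dvd coeff P t" if "t \<in> W" for t
        unfolding C_def using that by (intro Gcd_dvd) simp
      ultimately show "\<forall>t\<in>W. M dvd int k * coeff P t"
        unfolding M_def by (blast intro: mult_dvd_mono)
    qed
    finally show ?thesis .
  qed
  let ?N = "nc_cong A n M"
  define G where "G = nc_units Mod ?N"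
  define \<pi> where "\<pi> = (\<lambda>f. ?N #>\<^bsub>nc_units\<^esub> f)"
  interpret N: normal ?N nc_units by (rule nc_cong_normal)
  interpret G: group G unfolding G_def by (rule N.factorgroup_is_group)
  interpret \<pi>: group_hom nc_units G \<pi>
    unfolding G_def \<pi>_def
    by (intro group_hom.intro group_hom_axioms.intro group_nc_units N.factorgroup_is_group N.r_coset_hom_Mod)
  have \<pi>_one: "\<pi> f = \<one>\<^bsub>G\<^esub> \<longleftrightarrow> f - 1 \<in> nc_ideal A n M" if "f \<in> carrier nc_units" for f
  proof -
    have "\<pi> f = \<one>\<^bsub>G\<^esub> \<longleftrightarrow> f \<in> ?N"
      using that nc_units.coset_join1[OF _ that N.subgroup_axioms] nc_units.coset_join2[OF that N.subgroup_axioms]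
      by (auto simp: \<pi>_def G_def)
    then show ?thesis using that by (simp add: nc_cong_def)
  qed
  have word_\<pi>: "word_val G (\<pi> \<circ> p) w = \<pi> (word_val nc_units p w)"
    if "p \<in> A \<rightarrow> carrier nc_units" "fst ` set w \<subseteq> A" for p w
    using \<pi>.hom_word_val[OF that] by simp
  define g where "g = (\<lambda>a. \<pi> (1 + nc_var a))"
  have X: "(\<lambda>a. 1 + nc_var a) \<in> A \<rightarrow> carrier nc_units" by simp
  have v\<pi>: "word_val G g v = \<pi> (magnus v)"
    using word_\<pi>[OF X A(2)] by (simp add: g_def magnus_def comp_def)
  show thesis
  proof (rule that)
    show "group G" by (rule G.group_axioms)
    show "finite (carrier G)" unfolding G_def by (rule finite_nc_units_Mod[OF A(1) \<open>0 < M\<close>])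
    show gA: "g \<in> A \<rightarrow> carrier G"
      using \<pi>.hom_closed by (simp add: g_def)
    show "group.ord G (word_val G g v) = m"
    proof (rule G.ord_eqI)
      show "word_val G g v \<in> carrier G" by (rule G.word_val_closed[OF gA A(2)])
      show "word_val G g v [^]\<^bsub>G\<^esub> k = \<one>\<^bsub>G\<^esub> \<longleftrightarrow> m dvd k" for k :: nat
      proof -
        have U: "magnus v \<in> carrier nc_units" by simp
        have "word_val G g v [^]\<^bsub>G\<^esub> k = \<pi> (magnus v ^ k)"
          using \<pi>.hom_nat_pow[OF U, of k] by (simp add: v\<pi>)
        moreover have "magnus v ^ k \<in> carrier nc_units"
          using nc_units.nat_pow_closed[OF U, of k] by simp
        ultimately show ?thesis using \<pi>_one key by simp
      qed
    qed
    show "\<forall>\<sigma>\<in>A \<rightarrow> carrier G. word_val G \<sigma> v [^]\<^bsub>G\<^esub> m = \<one>\<^bsub>G\<^esub>"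
    proof
      fix \<sigma> assume \<sigma>: "\<sigma> \<in> A \<rightarrow> carrier G"
      \<comment> \<open>The assignment is lifted from the quotient to units, where the
        \<open>m\<close>-th power of \<open>v\<close> is evaluated as the word
        \<open>?w\<close>.\<close>
      have "\<forall>a\<in>A. \<exists>f. f \<in> carrier nc_units \<and> \<sigma> a = \<pi> f"
      proof
        fix a assume "a \<in> A"
        with \<sigma> have "\<sigma> a \<in> \<pi> ` carrier nc_units"
          unfolding G_def \<pi>_def carrier_FactGroup by (rule Pi_mem)
        then show "\<exists>f. f \<in> carrier nc_units \<and> \<sigma> a = \<pi> f" by blast
      qed
      then obtain p where p: "\<forall>a\<in>A. p a \<in> carrier nc_units \<and> \<sigma> a = \<pi> (p a)" by metis
      let ?w = "concat (replicate m v)"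
      have w: "fst ` set ?w \<subseteq> A" using A(2) by (simp add: image_subset_iff)
      have pA: "p \<in> A \<rightarrow> carrier nc_units" using p by auto
      have "magnus ?w = magnus v ^ m"
        using nc_units.word_val_replicate[OF X A(2), of m] by (simp add: magnus_def)
      then have "magnus ?w - 1 \<in> nc_ideal A n M" using key by simp
      \<comment> \<open>Substitution is additive, fixes 1 and preserves divisibility of coefficients
        by \<open>M\<close>, so the congruence of the expansion with 1 survives it.\<close>
      moreover have "nc_subst A n p (magnus ?w) - 1 = nc_subst A n p (magnus ?w - 1)"
        using nc_subst_one[OF A(1), of n p]
        by (simp add: nc_subst_def left_diff_distrib sum_subtractf)
      moreover have "nc_subst A n p f \<in> nc_ideal A n M" if f: "f \<in> nc_ideal A n M" for f
        unfolding nc_subst_def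
      proof (rule nc_ideal_sum)
        fix t assume "t \<in> {t. set t \<subseteq> A \<and> length t \<le> n}"
        then have "M dvd coeff f t" using f by (simp add: nc_ideal_def lists_eq_set)
        then show "of_int (coeff f t) * prod_list (map (\<lambda>a. p a - 1) t) \<in> nc_ideal A n M"
          by (simp add: nc_ideal_def)
      qed
      ultimately have "nc_subst A n p (magnus ?w) - 1 \<in> nc_ideal A n M" by simp
      from nc_ideal_add[OF word_val_nc_units[OF A(1) pA w, of n M] this]
      have "word_val nc_units p ?w - 1 \<in> nc_ideal A n M" by simp
      then have "\<pi> (word_val nc_units p ?w) = \<one>\<^bsub>G\<^esub>"
        using \<pi>_one nc_units.word_val_closed[OF pA w] by blast
      then have "word_val G (\<pi> \<circ> p) ?w = \<one>\<^bsub>G\<^esub>" using word_\<pi>[OF pA w] by simp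
      moreover have "word_val G \<sigma> ?w = word_val G (\<pi> \<circ> p) ?w"
        using p w by (intro word_val_cong) auto
      ultimately show "word_val G \<sigma> v [^]\<^bsub>G\<^esub> m = \<one>\<^bsub>G\<^esub>"
        using G.word_val_replicate[OF \<sigma> A(2), of m] by simp
    qed
  qed
qed

section \<open>Presented groups\<close>

definition pres_gen :: "'a set \<Rightarrow> 'a word set \<Rightarrow> 'a \<Rightarrow> 'a word set" where
  "pres_gen A R a = normal_closure (free_group A) R #>\<^bsub>free_group A\<^esub> free_gen a"

lemma carrier_free_group: "w \<in> carrier (free_group A) \<longleftrightarrow> reduced w \<and> fst ` set w \<subseteq> A"
  by (simp add: free_group_def)

lemma one_free_group [simp]: "\<one>\<^bsub>free_group A\<^esub> = []"
  by (simp add: free_group_def)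

lemma mult_free_group: "v \<otimes>\<^bsub>free_group A\<^esub> w = reduce (v @ w)"
  by (simp add: free_group_def)

lemma free_gen_carrier: "a \<in> A \<Longrightarrow> free_gen a \<in> carrier (free_group A)"
  by (simp add: carrier_free_group free_gen_def reduced_Cons)

lemma inv_free_gen:
  assumes "a \<in> A"
  shows "inv\<^bsub>free_group A\<^esub> free_gen a = [(a, False)]"
  by (rule group.inv_equality[OF group_free_group])
     (use assms in \<open>simp_all add: carrier_free_group free_gen_def reduced_Cons\<close>,
      simp add: free_group_def reduce_def inv_letter_def)

lemma word_val_free_gen:
  assumes "w \<in> carrier (free_group A)"
  shows "word_val (free_group A) free_gen w = w"
proof -
  have "word_val (free_group A) free_gen w = reduce w" if "fst ` set w \<subseteq> A" for w
    using that
  proof (induction w)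
    case (Cons l w)
    obtain a s where l: "l = (a, s)" by (cases l)
    have "(if s then free_gen a else inv\<^bsub>free_group A\<^esub> free_gen a) = [(a, s)]"
      using Cons.prems by (auto simp: l inv_free_gen) (simp add: free_gen_def)
    then have "word_val (free_group A) free_gen (l # w) = reduce ([(a, s)] @ reduce w)"
      using Cons by (simp only: word_val_Cons l fst_conv snd_conv mult_free_group) simp
    then show ?case by (simp only: reduce_append_right) (simp add: l)
  qed (simp add: reduce_def)
  with assms show ?thesis by (simp add: carrier_free_group reduce_reduced)
qed

lemma (in group) word_val_free_gen_letter:
  "\<sigma> a \<in> carrier G \<Longrightarrow> word_val G \<sigma> (free_gen a) = \<sigma> a"
  by (simp add: free_gen_def)

lemma (in group_hom) hom_commutator:
  "a \<in> carrier G \<Longrightarrow> b \<in> carrier G \<Longrightarrow> h (commutator G a b) = commutator H (h a) (h b)"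
  by (simp add: commutator_def)

context
  fixes A :: "'a set" and R :: "'a word set"
  assumes R: "R \<subseteq> carrier (free_group A)"
begin

lemma normal_closure_free_group: "normal_closure (free_group A) R \<lhd> free_group A"
  by (rule group.normal_closure_normal[OF group_free_group R])

lemma presented_group_proj:
  "group_hom (free_group A) (presented_group A R)
     (\<lambda>w. normal_closure (free_group A) R #>\<^bsub>free_group A\<^esub> w)"
  unfolding presented_group_def
  by (intro group_hom.intro group_hom_axioms.intro group_free_group
      normal.factorgroup_is_group[OF normal_closure_free_group]
      normal.r_coset_hom_Mod[OF normal_closure_free_group])

lemma pres_gen_carrier: "a \<in> A \<Longrightarrow> pres_gen A R a \<in> carrier (presented_group A R)"
  unfolding pres_gen_def
  by (rule group_hom.hom_closed[OF presented_group_proj free_gen_carrier])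

lemma presented_group_proj_word:
  assumes "w \<in> carrier (free_group A)"
  shows "normal_closure (free_group A) R #>\<^bsub>free_group A\<^esub> w
       = word_val (presented_group A R) (pres_gen A R) w"
proof -
  have "free_gen \<in> A \<rightarrow> carrier (free_group A)" by (simp add: free_gen_carrier)
  moreover have "fst ` set w \<subseteq> A" using assms by (simp add: carrier_free_group)
  ultimately show ?thesis
    using group_hom.hom_word_val[OF presented_group_proj, of free_gen A w]
    by (simp add: word_val_free_gen[OF assms] comp_def pres_gen_def[abs_def])
qed

lemma presented_group_cases:
  assumes "s \<in> carrier (presented_group A R)"
  obtains w where "fst ` set w \<subseteq> A" "s = word_val (presented_group A R) (pres_gen A R) w"
proof -
  obtain w where w: "w \<in> carrier (free_group A)"
    "s = normal_closure (free_group A) R #>\<^bsub>free_group A\<^esub> w"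
    using assms by (auto simp: presented_group_def carrier_FactGroup)
  then show thesis
    using that presented_group_proj_word by (auto simp: carrier_free_group)
qed

lemma presented_group_relator:
  assumes "r \<in> R"
  shows "word_val (presented_group A R) (pres_gen A R) r = \<one>\<^bsub>presented_group A R\<^esub>"
proof -
  have r: "r \<in> carrier (free_group A)" using assms R by blast
  moreover have "r \<in> normal_closure (free_group A) R"
    using assms by (auto simp: normal_closure_def)
  ultimately have "normal_closure (free_group A) R #>\<^bsub>free_group A\<^esub> r = normal_closure (free_group A) R"
    by (intro group.coset_join2[OF group_free_group] normal_imp_subgroup normal_closure_free_group)
  then show ?thesis
    using presented_group_proj_word[OF r] by (simp add: presented_group_def)
qed

text \<open>The universal property of a presentation (von Dyck): the kernel of evaluation is normal
  and contains the relators, hence their normal closure, so evaluation factors through the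
  quotient.\<close>

lemma presented_group_hom:
  assumes "group H" and \<sigma>: "\<sigma> \<in> A \<rightarrow> carrier H"
    and rel: "\<And>r. r \<in> R \<Longrightarrow> word_val H \<sigma> r = \<one>\<^bsub>H\<^esub>"
  obtains h where "group_hom (presented_group A R) H h" "\<And>a. a \<in> A \<Longrightarrow> h (pres_gen A R a) = \<sigma> a"
proof -
  let ?F = "free_group A" and ?N = "normal_closure (free_group A) R"
  interpret H: group H by fact
  interpret \<phi>: group_hom ?F H "word_val H \<sigma>"
    by (intro group_hom.intro group_hom_axioms.intro group_free_group assms H.word_val_hom)
  have "R \<subseteq> kernel ?F H (word_val H \<sigma>)"
    using rel R by (auto simp: kernel_def)
  then have N: "?N \<subseteq> kernel ?F H (word_val H \<sigma>)"
    using \<phi>.normal_kernel by (auto simp: normal_closure_def)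
  have sub: "subgroup ?N ?F" by (intro normal_imp_subgroup normal_closure_free_group)
  have "word_val H \<sigma> v = word_val H \<sigma> w"
    if "v \<in> carrier ?F" "w \<in> carrier ?F" "?N #>\<^bsub>?F\<^esub> v = ?N #>\<^bsub>?F\<^esub> w" for v w
  proof -
    have "v \<in> ?N #>\<^bsub>?F\<^esub> w"
      using group.rcos_self[OF group_free_group that(1) sub] that(3) by simp
    then obtain k where k: "k \<in> ?N" "v = k \<otimes>\<^bsub>?F\<^esub> w" by (auto simp: r_coset_def)
    with N have "k \<in> carrier ?F" "word_val H \<sigma> k = \<one>\<^bsub>H\<^esub>" by (auto simp: kernel_def)
    then show ?thesis using k(2) that(2) by simp
  qed
  from FactGroup_universal[OF \<phi>.homh normal_closure_free_group this]
  obtain h where h: "h \<in> hom (?F Mod ?N) H" "\<And>w. w \<in> carrier ?F \<Longrightarrow> h (?N #>\<^bsub>?F\<^esub> w) = word_val H \<sigma> w"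
    by blast
  show thesis
  proof (rule that)
    show "group_hom (presented_group A R) H h"
      using h(1) group_presented_group[OF R] \<open>group H\<close>
      by (intro group_hom.intro group_hom_axioms.intro) (simp_all add: presented_group_def)
    fix a assume a: "a \<in> A"
    then show "h (pres_gen A R a) = \<sigma> a"
      using h(2)[OF free_gen_carrier[OF a]] H.word_val_free_gen_letter[of \<sigma> a] \<sigma>
      by (auto simp: pres_gen_def)
  qed
qed

end

section \<open>Conjugation by powers of an element\<close>

lemma (in group) conj_int_pow_Suc:
  assumes "x \<in> carrier G" "z \<in> carrier G"
  shows "x [^] (1 + i) \<otimes> z \<otimes> x [^] (- (1 + i)) = x \<otimes> (x [^] (i::int) \<otimes> z \<otimes> x [^] (- i)) \<otimes> inv x"
proof -
  have "x [^] (1 + i) = x \<otimes> x [^] i"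
    using int_pow_mult[OF assms(1), of 1 i] assms by simp
  moreover have "x [^] (- (1 + i)) = x [^] (- i + - 1)" by (simp add: algebra_simps)
  then have "x [^] (- (1 + i)) = x [^] (- i) \<otimes> inv x"
    unfolding int_pow_mult[OF assms(1)] int_pow_neg[OF assms(1), of 1] using assms by simp
  ultimately show ?thesis
    using assms by (simp add: m_assoc)
qed

text \<open>A sequence shifted by conjugation with \<open>x\<close> consists of conjugates under
  powers of \<open>x\<close>. This later computes \<open>letter_val\<close> for letters read modulo
  \<open>N\<close>.\<close>

lemma (in group) conj_int_pow:
  assumes x: "x \<in> carrier G" and t: "\<And>i. t i \<in> carrier G" "\<And>i. x \<otimes> t i \<otimes> inv x = t (i + 1)"
  shows "x [^] (i::int) \<otimes> t 0 \<otimes> x [^] (- i) = t i"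
proof (induction i rule: int_induct[of _ 0])
  case base
  show ?case using t by simp
next
  case (step1 i)
  then show ?case
    using conj_int_pow_Suc[OF x t(1), of i 0] t(2)[of i] by (simp add: add.commute)
next
  case (step2 i)
  have c: "x [^] (i - 1) \<otimes> t 0 \<otimes> x [^] (- (i - 1)) \<in> carrier G" using x t by simp
  \<comment> \<open>Downwards, the claim for \<open>i - 1\<close> conjugated by \<open>x\<close> is
    the known claim for \<open>i\<close>; then \<open>x\<close> is cancelled on both sides.\<close>
  have "x \<otimes> (x [^] (i - 1) \<otimes> t 0 \<otimes> x [^] (- (i - 1))) \<otimes> inv x = x \<otimes> t (i - 1) \<otimes> inv x"
    using conj_int_pow_Suc[OF x t(1), of "i - 1" 0] t(2)[of "i - 1"] step2 by simp
  then have "x \<otimes> (x [^] (i - 1) \<otimes> t 0 \<otimes> x [^] (- (i - 1))) = x \<otimes> t (i - 1)"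
    by (rule r_cancel) (use x t(1) c in simp_all)
  then show ?case
    by (rule l_cancel) (use x t(1) c in simp_all)
qed

lemma (in group) subgroup_word_val:
  assumes "subgroup L G" "\<And>a. a \<in> fst ` set w \<Longrightarrow> \<sigma> a \<in> L"
  shows "word_val G \<sigma> w \<in> L"
  using assms(2)
proof (induction w)
  case Nil
  then show ?case using subgroup.one_closed[OF assms(1)] by simp
next
  case (Cons l w)
  then show ?case
    using subgroup.m_closed[OF assms(1)] subgroup.m_inv_closed[OF assms(1)] by simp
qed


section \<open>The normal subgroup generated by \<open>y\<close> and the conjugates of the \<open>z\<^sub>j\<close>\<close>

type_synonym letter = "(nat \<times> int) option"

text \<open>The letter \<open>None\<close> stands for \<open>y\<close>, and \<open>Some (j, i)\<close> for \<open>x\<^sup>i z\<^sub>j x\<^sup>-\<^sup>i\<close>.\<close>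

fun letter_val :: "('b, 'c) monoid_scheme \<Rightarrow> (gen_xyz \<Rightarrow> 'b) \<Rightarrow> letter \<Rightarrow> 'b" where
  "letter_val G \<gamma> None = \<gamma> Gen_y"
| "letter_val G \<gamma> (Some (j, i)) =
     \<gamma> Gen_x [^]\<^bsub>G\<^esub> i \<otimes>\<^bsub>G\<^esub> \<gamma> (Gen_z j) \<otimes>\<^bsub>G\<^esub> \<gamma> Gen_x [^]\<^bsub>G\<^esub> (- i)"

fun letter_of :: "gen_xyz \<Rightarrow> letter" where
  "letter_of (Gen_z j) = Some (j, 0)"
| "letter_of _ = None"

abbreviation letters :: "nat \<Rightarrow> int set \<Rightarrow> letter set" where
  "letters d I \<equiv> insert None (Some ` ({1..d} \<times> I))"

text \<open>The subgroup \<open>L\<close> generated by the letters is normalised by \<open>x\<close>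
  and its inverse, so all powers of \<open>x\<close> can be collected on the right. Taking
  \<open>v\<close> in the free group makes it reduced, as the Magnus expansion requires.\<close>

lemma (in group) word_normal_form:
  fixes \<gamma> :: "gen_xyz \<Rightarrow> 'a" and d :: nat
  defines "A \<equiv> {Gen_x, Gen_y} \<union> Gen_z ` {1..d}"
  assumes \<gamma>: "\<gamma> \<in> A \<rightarrow> carrier G" and u: "fst ` set u \<subseteq> Gen_z ` {1..d}"
    and rel: "commutator G (\<gamma> Gen_x) (\<gamma> Gen_y) \<otimes> word_val G \<gamma> u = \<one>"
    and w: "fst ` set w \<subseteq> A"
  shows "\<exists>v\<in>carrier (free_group (letters d UNIV)). \<exists>k::int.
    word_val G \<gamma> w = word_val G (letter_val G \<gamma>) v \<otimes> \<gamma> Gen_x [^] k"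
proof -
  let ?\<beta> = "letter_val G \<gamma>" and ?\<Lambda> = "letters d UNIV"
  define x where "x = \<gamma> Gen_x"
  define y where "y = \<gamma> Gen_y"
  define V where "V = word_val G \<gamma> u"
  have x: "x \<in> carrier G" and y: "y \<in> carrier G" using \<gamma> by (auto simp: x_def y_def A_def)
  have z: "\<gamma> (Gen_z j) \<in> carrier G" if "j \<in> {1..d}" for j using \<gamma> that by (auto simp: A_def)
  have \<beta>: "?\<beta> \<in> ?\<Lambda> \<rightarrow> carrier G" using x y z by (auto simp: x_def y_def)
  define L where "L = word_val G ?\<beta> ` carrier (free_group ?\<Lambda>)"
  interpret \<phi>: group_hom "free_group ?\<Lambda>" G "word_val G ?\<beta>"
    by (intro group_hom.intro group_hom_axioms.intro group_free_group word_val_hom \<beta> group_axioms)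
  have L: "subgroup L G" unfolding L_def by (rule \<phi>.img_is_subgroup)
  interpret L: subgroup L G by (rule L)
  have \<beta>L: "?\<beta> a \<in> L" if "a \<in> ?\<Lambda>" for a
  proof -
    have "?\<beta> a = word_val G ?\<beta> (free_gen a)"
      using that \<beta> by (intro word_val_free_gen_letter[symmetric]) (rule Pi_mem)
    then show ?thesis unfolding L_def using free_gen_carrier[OF that] by (rule image_eqI)
  qed
  have yL: "y \<in> L" using \<beta>L[of None] by (simp add: y_def)
  have zL: "\<gamma> (Gen_z j) \<in> L" if "j \<in> {1..d}" for j
    using \<beta>L[of "Some (j, 0)"] that z by simp
  have VL: "V \<in> L"
    unfolding V_def using zL u by (intro subgroup_word_val[OF L]) auto
  have V: "V \<in> carrier G" using VL by (rule L.mem_carrier)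
  have conj_hom: "group_hom G G (\<lambda>g. c \<otimes> g \<otimes> inv c)" if "c \<in> carrier G" for c
    using that by unfold_locales (auto intro!: homI simp: m_assoc inv_solve_left)
  have conj_z: "x [^] e \<otimes> ?\<beta> (Some (j, i)) \<otimes> inv (x [^] e) = ?\<beta> (Some (j, e + i))"
    if "j \<in> {1..d}" for e i :: int and j
  proof -
    have "- (e + i) = - i + - e" by simp
    then have "x [^] (- (e + i)) = x [^] (- i) \<otimes> inv (x [^] e)"
      using x by (simp only: int_pow_mult int_pow_neg)
    then show ?thesis
      using x z[OF that] by (simp add: x_def[symmetric] int_pow_mult m_assoc)
  qed
  \<comment> \<open>Only the \<open>z\<close> generators occur in \<open>u\<close>, and conjugation
    by a power of \<open>x\<close> merely shifts their indices.\<close>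
  have conj_V: "x [^] e \<otimes> V \<otimes> inv (x [^] e) \<in> L" for e :: int
  proof -
    interpret c: group_hom G G "\<lambda>g. x [^] e \<otimes> g \<otimes> inv (x [^] e)" by (rule conj_hom) (simp add: x)
    have "\<gamma> \<in> A \<rightarrow> carrier G" "fst ` set u \<subseteq> A" using \<gamma> u by (auto simp: A_def)
    from c.hom_word_val[OF this]
    have "x [^] e \<otimes> V \<otimes> inv (x [^] e) = word_val G ((\<lambda>g. x [^] e \<otimes> g \<otimes> inv (x [^] e)) \<circ> \<gamma>) u"
      by (simp add: V_def)
    also have "\<dots> \<in> L"
    proof (rule subgroup_word_val[OF L])
      fix a assume "a \<in> fst ` set u"
      then obtain j where j: "j \<in> {1..d}" "a = Gen_z j" using u by blast
      then show "((\<lambda>g. x [^] e \<otimes> g \<otimes> inv (x [^] e)) \<circ> \<gamma>) a \<in> L"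
        using conj_z[OF j(1), of e 0] z[OF j(1)] \<beta>L[of "Some (j, e)"] by simp
    qed
    finally show ?thesis .
  qed
  have rel': "x \<otimes> y \<otimes> inv x = inv V \<otimes> y"
  proof -
    have "x \<otimes> y \<otimes> inv x \<otimes> inv y \<otimes> V = \<one>"
      using rel by (simp add: commutator_def x_def y_def V_def)
    then have "x \<otimes> y \<otimes> inv x \<otimes> inv y = inv V"
      using x y V by (intro inv_equality[symmetric]) auto
    then show ?thesis
      by (rule inv_solve_right'[THEN iffD1, rotated -1]) (use x y V in simp_all)
  qed
  have conj_y: "x [^] e \<otimes> y \<otimes> inv (x [^] e) \<in> L" if "e = 1 \<or> e = - 1" for e :: int
    using that
  proof
    assume "e = 1"
    then show ?thesis using rel' VL yL x by simp
  next
    assume e: "e = - 1"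
    \<comment> \<open>Inserting \<open>V\<close> and its inverse makes \<open>rel'\<close>
      applicable and expresses the conjugate by \<open>inv x\<close> as a conjugate of
      \<open>V\<close> times \<open>y\<close>.\<close>
    have "inv x \<otimes> y \<otimes> x = inv x \<otimes> (V \<otimes> inv V) \<otimes> y \<otimes> x"
      using x y V by simp
    also have "\<dots> = inv x \<otimes> V \<otimes> (inv V \<otimes> y) \<otimes> x"
      using x y V by (simp only: m_assoc m_closed inv_closed)
    also have "\<dots> = (inv x \<otimes> V \<otimes> x) \<otimes> y"
      unfolding rel'[symmetric] using x y V by (simp add: m_assoc)
    finally show ?thesis
      using conj_V[of "- 1"] yL x by (simp add: e int_pow_neg)
  qed
  have conj_L: "x [^] e \<otimes> g \<otimes> inv (x [^] e) \<in> L" if e: "e = 1 \<or> e = - 1" and g: "g \<in> L" for e :: int and g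
  proof -
    interpret c: group_hom G G "\<lambda>g. x [^] e \<otimes> g \<otimes> inv (x [^] e)" by (rule conj_hom) (simp add: x)
    obtain v where v: "v \<in> carrier (free_group ?\<Lambda>)" "g = word_val G ?\<beta> v"
      using g by (auto simp: L_def)
    then have v\<Lambda>: "fst ` set v \<subseteq> ?\<Lambda>" by (simp add: carrier_free_group)
    have "word_val G ((\<lambda>g. x [^] e \<otimes> g \<otimes> inv (x [^] e)) \<circ> ?\<beta>) v \<in> L"
    proof (rule subgroup_word_val[OF L])
      fix a assume "a \<in> fst ` set v"
      with v\<Lambda> have "a \<in> ?\<Lambda>" by (rule subsetD)
      then consider "a = None" | j i where "j \<in> {1..d}" "a = Some (j, i)" by blast
      then show "((\<lambda>g. x [^] e \<otimes> g \<otimes> inv (x [^] e)) \<circ> ?\<beta>) a \<in> L"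
      proof cases
        case 1
        then show ?thesis using conj_y[OF e] by (simp add: y_def)
      next
        case 2
        then show ?thesis using conj_z[OF 2(1), of e i] \<beta>L[of "Some (j, e + i)"]
          by (simp del: letter_val.simps)
      qed
    qed
    then show ?thesis using c.hom_word_val[OF \<beta> v\<Lambda>] v(2) by simp
  qed
  have "\<exists>g\<in>L. \<exists>k::int. word_val G \<gamma> w = g \<otimes> x [^] k"
    using w
  proof (induction w)
    case Nil
    show ?case by (intro bexI[of _ \<one>] exI[of _ 0]) auto
  next
    case (Cons l w)
    then obtain g k where g: "g \<in> L" and k: "word_val G \<gamma> w = g \<otimes> x [^] (k::int)" by auto
    have gG: "g \<in> carrier G" using g by (rule L.mem_carrier)
    obtain a s where l: "l = (a, s)" by (cases l)
    show ?case
    proof (cases "a = Gen_x")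
      case True
      define e where "e = (if s then 1 else - 1 :: int)"
      have "word_val G \<gamma> (l # w) = x [^] e \<otimes> (g \<otimes> x [^] k)"
        using x k True by (simp add: l e_def x_def int_pow_neg)
      also have "\<dots> = (x [^] e \<otimes> g \<otimes> inv (x [^] e)) \<otimes> x [^] (e + k)"
        using x gG by (simp add: int_pow_mult m_assoc)
          (simp flip: m_assoc)
      finally show ?thesis
        using conj_L[OF _ g, of e] by (auto simp: e_def)
    next
      case False
      then have "\<gamma> a \<in> L" using Cons.prems zL yL by (auto simp: l A_def y_def)
      then have h: "(if s then \<gamma> a else inv \<gamma> a) \<in> L" by simp
      have "word_val G \<gamma> (l # w) = ((if s then \<gamma> a else inv \<gamma> a) \<otimes> g) \<otimes> x [^] k"
        using L.mem_carrier[OF h] gG x k by (simp add: l m_assoc)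
      with L.m_closed[OF h g] show ?thesis by blast
    qed
  qed
  then show ?thesis unfolding L_def x_def by blast
qed

section \<open>Skew permutations\<close>

definition perm_group :: "'a set \<Rightarrow> ('a \<Rightarrow> 'a) monoid" where
  "perm_group T = \<lparr>carrier = {p. p permutes T}, monoid.mult = (\<circ>), one = id\<rparr>"

lemma perm_group_simps [simp]:
  "p \<in> carrier (perm_group T) \<longleftrightarrow> p permutes T"
  "p \<otimes>\<^bsub>perm_group T\<^esub> q = p \<circ> q" "\<one>\<^bsub>perm_group T\<^esub> = id"
  by (simp_all add: perm_group_def)

lemma group_perm_group: "group (perm_group T)"
proof (rule groupI)
  fix p assume "p \<in> carrier (perm_group T)"
  then have p: "p permutes T" by simp
  show "\<exists>q\<in>carrier (perm_group T). q \<otimes>\<^bsub>perm_group T\<^esub> p = \<one>\<^bsub>perm_group T\<^esub>"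
    using permutes_inv[OF p] permutes_inv_o(2)[OF p] by (intro bexI[of _ "inv_into UNIV p"]) simp_all
qed (auto intro: permutes_compose permutes_id simp: comp_assoc)

lemma finite_perm_group: "finite T \<Longrightarrow> finite (carrier (perm_group T))"
  using finite_permutations[of T] by (simp add: perm_group_def)

text \<open>Translation by \<open>\<theta> q\<close> on the fibre over \<open>q\<close>. These
  permutations form a copy of the power of \<open>G\<close> indexed by \<open>Q\<close>, inside a
  group that also contains the permutations of \<open>Q\<close>, as in a wreath product.\<close>

definition skew :: "('b, 'c) monoid_scheme \<Rightarrow> 'q set \<Rightarrow> ('q \<Rightarrow> 'b) \<Rightarrow> 'q \<times> 'b \<Rightarrow> 'q \<times> 'b" where
  "skew G Q \<theta> = (\<lambda>(q, g). if q \<in> Q \<and> g \<in> carrier G then (q, \<theta> q \<otimes>\<^bsub>G\<^esub> g) else (q, g))"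

lemma skew_cong: "(\<And>q. q \<in> Q \<Longrightarrow> \<theta> q = \<eta> q) \<Longrightarrow> skew G Q \<theta> = skew G Q \<eta>"
  by (auto simp: skew_def fun_eq_iff)

context group
begin

lemma skew_mult:
  assumes "\<eta> \<in> Q \<rightarrow> carrier G" "\<theta> \<in> Q \<rightarrow> carrier G"
  shows "skew G Q \<theta> \<circ> skew G Q \<eta> = skew G Q (\<lambda>q. \<theta> q \<otimes> \<eta> q)"
  using assms by (auto simp: skew_def fun_eq_iff Pi_iff m_assoc)

lemma skew_one: "skew G Q (\<lambda>q. \<one>) = id"
  by (auto simp: skew_def fun_eq_iff)

lemma skew_permutes:
  assumes "\<theta> \<in> Q \<rightarrow> carrier G"
  shows "skew G Q \<theta> permutes Q \<times> carrier G"
proof (rule bij_imp_permutes)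
  have inv: "(\<lambda>q. inv \<theta> q) \<in> Q \<rightarrow> carrier G" using assms by auto
  show "bij_betw (skew G Q \<theta>) (Q \<times> carrier G) (Q \<times> carrier G)"
    by (rule bij_betw_byWitness[of _ "skew G Q (\<lambda>q. inv \<theta> q)"])
       (use assms inv in \<open>auto simp: skew_def Pi_iff simp flip: m_assoc\<close>)
qed (auto simp: skew_def split: if_splits)

lemma inv_skew:
  assumes "\<theta> \<in> Q \<rightarrow> carrier G"
  shows "inv\<^bsub>perm_group (Q \<times> carrier G)\<^esub> skew G Q \<theta> = skew G Q (\<lambda>q. inv \<theta> q)"
proof (rule group.inv_equality[OF group_perm_group])
  have inv: "(\<lambda>q. inv \<theta> q) \<in> Q \<rightarrow> carrier G" using assms by auto
  have "skew G Q (\<lambda>q. inv \<theta> q) \<circ> skew G Q \<theta> = skew G Q (\<lambda>q. inv \<theta> q \<otimes> \<theta> q)"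
    by (rule skew_mult[OF assms inv])
  also have "\<dots> = skew G Q (\<lambda>q. \<one>)" using assms by (intro skew_cong) (auto simp: Pi_iff)
  finally show "skew G Q (\<lambda>q. inv \<theta> q) \<otimes>\<^bsub>perm_group (Q \<times> carrier G)\<^esub> skew G Q \<theta> =
      \<one>\<^bsub>perm_group (Q \<times> carrier G)\<^esub>"
    by (simp add: skew_one)
  show "skew G Q \<theta> \<in> carrier (perm_group (Q \<times> carrier G))"
    "skew G Q (\<lambda>q. inv \<theta> q) \<in> carrier (perm_group (Q \<times> carrier G))"
    using skew_permutes assms inv by simp_all
qed

lemma skew_word_val:
  assumes "\<And>a. a \<in> fst ` set w \<Longrightarrow> \<theta> a \<in> Q \<rightarrow> carrier G"
  shows "word_val (perm_group (Q \<times> carrier G)) (\<lambda>a. skew G Q (\<theta> a)) w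
       = skew G Q (\<lambda>q. word_val G (\<lambda>a. \<theta> a q) w)"
  using assms
proof (induction w)
  case Nil
  then show ?case by (simp add: skew_one)
next
  case (Cons l w)
  have l: "\<theta> (fst l) \<in> Q \<rightarrow> carrier G" using Cons.prems by simp
  have w: "(\<lambda>q. word_val G (\<lambda>a. \<theta> a q) w) \<in> Q \<rightarrow> carrier G"
  proof
    fix q assume "q \<in> Q"
    then have "(\<lambda>a. \<theta> a q) \<in> fst ` set w \<rightarrow> carrier G"
      using Cons.prems by (auto simp: Pi_iff)
    then show "word_val G (\<lambda>a. \<theta> a q) w \<in> carrier G" by (rule word_val_closed) simp
  qed
  have il: "(\<lambda>q. inv \<theta> (fst l) q) \<in> Q \<rightarrow> carrier G" using l by auto
  have IH: "word_val (perm_group (Q \<times> carrier G)) (\<lambda>a. skew G Q (\<theta> a)) w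
       = skew G Q (\<lambda>q. word_val G (\<lambda>a. \<theta> a q) w)"
    using Cons by simp
  show ?case
    by (cases "snd l")
       (simp_all only: word_val_Cons perm_group_simps IH inv_skew[OF l] skew_mult[OF w l]
          skew_mult[OF w il] if_True if_False)
qed

lemma skew_pow:
  assumes "\<theta> \<in> Q \<rightarrow> carrier G"
  shows "skew G Q \<theta> [^]\<^bsub>perm_group (Q \<times> carrier G)\<^esub> (k::nat) = skew G Q (\<lambda>q. \<theta> q [^] k)"
proof (induction k)
  case (Suc k)
  have "(\<lambda>q. \<theta> q [^] k) \<in> Q \<rightarrow> carrier G" using assms by auto
  from skew_mult[OF assms this] Suc show ?case by simp
qed (simp add: skew_one)

lemma skew_eq_id_iff:
  assumes "\<theta> \<in> Q \<rightarrow> carrier G"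
  shows "skew G Q \<theta> = id \<longleftrightarrow> (\<forall>q\<in>Q. \<theta> q = \<one>)"
proof
  assume *: "skew G Q \<theta> = id"
  show "\<forall>q\<in>Q. \<theta> q = \<one>"
  proof
    fix q assume "q \<in> Q"
    moreover from this have "\<theta> q \<in> carrier G" by (rule Pi_mem[OF assms])
    ultimately show "\<theta> q = \<one>"
      using fun_cong[OF *, of "(q, \<one>)"] by (simp add: skew_def)
  qed
next
  assume "\<forall>q\<in>Q. \<theta> q = \<one>"
  then have "skew G Q \<theta> = skew G Q (\<lambda>q. \<one>)" by (intro skew_cong) auto
  then show "skew G Q \<theta> = id" by (simp add: skew_one)
qed

end


section \<open>Potency\<close>

text \<open>Stated with injectivity on the occurring letters, since reducing indices modulo
  \<open>N\<close> is injective only there.\<close>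

lemma reduced_map_apfst:
  assumes "inj_on f (fst ` set w)" "reduced w"
  shows "reduced (map (apfst f) w)"
  using assms
proof (induction w)
  case (Cons k w)
  have "reduced (map (apfst f) w)"
  proof (rule Cons.IH)
    show "inj_on f (fst ` set w)" using Cons.prems(1) by (rule inj_on_subset) auto
    show "reduced w" using Cons.prems(2) by (simp add: reduced_Cons)
  qed
  moreover have "hd (map (apfst f) w) \<noteq> inv_letter (apfst f k)" if "w \<noteq> []"
  proof
    assume "hd (map (apfst f) w) = inv_letter (apfst f k)"
    then have eq: "f (fst (hd w)) = f (fst k)" "snd (hd w) \<noteq> snd k"
      using that by (simp_all add: hd_map inv_letter_def prod_eq_iff)
    have "fst (hd w) = fst k"
      by (rule inj_onD[OF Cons.prems(1) eq(1)]) (use that in auto)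
    with eq(2) have "hd w = inv_letter k"
      by (auto simp: inv_letter_def prod_eq_iff)
    then show False using Cons.prems(2) that by (simp add: reduced_Cons)
  qed
  ultimately show ?case by (cases w) (auto simp: reduced_Cons)
qed simp

text \<open>Transports a finite quotient to a carrier in \<open>nat\<close>. The two cases of the
  main proof use groups of different types.\<close>

lemma finite_quotient_in_nat:
  fixes H :: "'c monoid" and S :: "('a, 'b) monoid_scheme"
  assumes H: "group H" "finite (carrier H)" and h: "h \<in> hom S H" and s: "s \<in> carrier S"
  shows "\<exists>(K :: nat monoid) h'. group K \<and> finite (carrier K) \<and> h' \<in> hom S K \<and>
    group.ord K (h' s) = group.ord H (h s)"
proof -
  interpret H: group H by fact
  obtain f :: "'c \<Rightarrow> nat" where f: "inj_on f (carrier H)"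
    using finite_imp_inj_to_nat_seg[OF H(2)] by blast
  let ?K = "image_group f H"
  have K: "group ?K" and iso: "f \<in> iso H ?K"
    using H.inj_imp_image_group_is_group[OF f] inj_imp_image_group_iso[OF f] by auto
  have "finite (carrier ?K)"
    using H(2) by (simp add: image_group_carrier)
  moreover have "f \<circ> h \<in> hom S ?K"
    using h iso by (auto simp: iso_def intro: hom_compose)
  moreover have "group.ord ?K ((f \<circ> h) s) = group.ord H (h s)"
    using ord_iso[OF H(1) K iso, of "h s"] h s by (auto simp: hom_def)
  ultimately show ?thesis using K by blast
qed

text \<open>A point of \<open>Q\<close> assigns values in \<open>G\<close> to the letters with indices modulo \<open>N\<close>; the inverse of
  \<open>x\<close> acts on these assignments as it acts by conjugation on the letters.\<close>

lemma skew_quotient: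
  fixes G :: "('b, 'c) monoid_scheme" and u :: "gen_xyz word" and N :: int and d :: nat
  defines "A \<equiv> letters d {0..<N}"
  defines "Q \<equiv> A \<rightarrow>\<^sub>E carrier G"
  defines "H \<equiv> perm_group (Q \<times> carrier G)"
  assumes "group G" "finite (carrier G)" "0 < N" and u: "fst ` set u \<subseteq> Gen_z ` {1..d}"
  obtains \<tau> where "\<tau> \<in> {Gen_x, Gen_y} \<union> Gen_z ` {1..d} \<rightarrow> carrier H"
    "commutator H (\<tau> Gen_x) (\<tau> Gen_y) \<otimes>\<^bsub>H\<^esub> word_val H \<tau> u = \<one>\<^bsub>H\<^esub>"
    "\<And>a. a \<in> letters d UNIV \<Longrightarrow>
       letter_val H \<tau> a = skew G Q (\<lambda>\<sigma>. \<sigma> (map_option (apsnd (\<lambda>i. i mod N)) a))"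
proof -
  interpret G: group G by fact
  interpret H: group H unfolding H_def by (rule group_perm_group)
  have AF: "finite A" by (simp add: A_def)
  have finQ: "finite Q" unfolding Q_def using AF assms(5) by (intro finite_PiE) auto
  have Q: "\<sigma> a \<in> carrier G" if "\<sigma> \<in> Q" "a \<in> A" for \<sigma> a using that by (auto simp: Q_def)
  have letter_u: "letter_of b \<in> A" if "b \<in> Gen_z ` {1..d}" for b
    using that \<open>0 < N\<close> by (auto simp: A_def)
  define U where "U \<sigma> = word_val G (\<lambda>b. \<sigma> (letter_of b)) u" for \<sigma> :: "letter \<Rightarrow> 'b"
  have U: "U \<sigma> \<in> carrier G" if "\<sigma> \<in> Q" for \<sigma>
    unfolding U_def using Q[OF that] letter_u u
    by (intro G.word_val_closed[where A = "Gen_z ` {1..d}"]) auto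
  \<comment> \<open>The value of \<open>shift \<sigma>\<close> at a letter is the value under
    \<open>\<sigma>\<close> of that letter conjugated by \<open>x\<close>: the inverse of
    \<open>u\<close> times \<open>y\<close> for \<open>None\<close>, the next index
    otherwise.\<close>
  define shift where "shift \<sigma> = restrict (\<lambda>a. case a of
      None \<Rightarrow> inv\<^bsub>G\<^esub> U \<sigma> \<otimes>\<^bsub>G\<^esub> \<sigma> None
    | Some (j, i) \<Rightarrow> \<sigma> (Some (j, (i + 1) mod N))) A" for \<sigma> :: "letter \<Rightarrow> 'b"
  have nextA: "Some (j, i mod N) \<in> A" if "j \<in> {1..d}" for j i
    using that \<open>0 < N\<close> by (simp add: A_def)
  have shift_Some: "shift \<sigma> (Some (j, i mod N)) = \<sigma> (Some (j, (i + 1) mod N))" if "j \<in> {1..d}" for \<sigma> j i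
    using nextA[OF that] by (simp add: shift_def mod_simps)
  have shift_None: "shift \<sigma> None = inv\<^bsub>G\<^esub> U \<sigma> \<otimes>\<^bsub>G\<^esub> \<sigma> None" for \<sigma>
    by (simp add: shift_def A_def)
  have shiftQ: "shift \<sigma> \<in> Q" if \<sigma>: "\<sigma> \<in> Q" for \<sigma>
    unfolding Q_def
  proof
    fix a assume a: "a \<in> A"
    show "shift \<sigma> a \<in> carrier G"
    proof (cases a)
      case None
      then show ?thesis using shift_None U[OF \<sigma>] Q[OF \<sigma> a] by simp
    next
      case (Some ji)
      then obtain j i where ji: "a = Some (j, i)" "j \<in> {1..d}" "0 \<le> i" "i < N"
        using a by (auto simp: A_def)
      then show ?thesis
        using shift_Some[OF ji(2), of \<sigma> i] Q[OF \<sigma> nextA[OF ji(2)], of "i + 1"] by simp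
    qed
  qed (simp add: shift_def)
  have "inj_on shift Q"
  proof (rule inj_onI)
    fix \<sigma> \<tau> assume \<sigma>: "\<sigma> \<in> Q" and \<tau>: "\<tau> \<in> Q" and eq: "shift \<sigma> = shift \<tau>"
    \<comment> \<open>The values at the \<open>z\<close> letters are recovered first; they determine
      \<open>U\<close>, and then the value at \<open>y\<close> is recovered too.\<close>
    have Some: "\<sigma> (Some (j, i mod N)) = \<tau> (Some (j, i mod N))" if "j \<in> {1..d}" for j i
      using shift_Some[OF that, of \<sigma> "i - 1"] shift_Some[OF that, of \<tau> "i - 1"] eq by simp
    have "U \<sigma> = U \<tau>"
      unfolding U_def
    proof (rule word_val_cong)
      fix b assume "b \<in> fst ` set u"
      then obtain j where "j \<in> {1..d}" "b = Gen_z j" using u by blast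
      then show "\<sigma> (letter_of b) = \<tau> (letter_of b)" using Some[of j 0] by simp
    qed
    moreover have "inv\<^bsub>G\<^esub> U \<sigma> \<otimes>\<^bsub>G\<^esub> \<sigma> None = inv\<^bsub>G\<^esub> U \<tau> \<otimes>\<^bsub>G\<^esub> \<tau> None"
      using shift_None eq by metis
    moreover have "None \<in> A" by (simp add: A_def)
    ultimately have None: "\<sigma> None = \<tau> None"
      using U[OF \<tau>] Q[OF \<sigma>] Q[OF \<tau>] by simp
    show "\<sigma> = \<tau>"
    proof (rule PiE_ext)
      show "\<sigma> \<in> A \<rightarrow>\<^sub>E carrier G" "\<tau> \<in> A \<rightarrow>\<^sub>E carrier G" using \<sigma> \<tau> by (simp_all add: Q_def)
      fix a assume "a \<in> A"
      then consider "a = None" | j i where "j \<in> {1..d}" "0 \<le> i" "i < N" "a = Some (j, i)"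
        by (auto simp: A_def)
      then show "\<sigma> a = \<tau> a"
      proof cases
        case 2
        then show ?thesis using Some[of j i] by simp
      qed (simp add: None)
    qed
  qed
  moreover from this have "shift ` Q = Q"
    using shiftQ finQ by (intro endo_inj_surj) auto
  ultimately have bij: "bij_betw shift Q Q" by (simp add: bij_betw_def)
  define p where "p = (\<lambda>(\<sigma>, g). if \<sigma> \<in> Q \<and> g \<in> carrier G then (shift \<sigma>, g) else (\<sigma>, g))"
  have p: "p \<in> carrier H"
    unfolding H_def perm_group_simps
  proof (rule bij_imp_permutes)
    have "bij_betw (map_prod shift id) (Q \<times> carrier G) (Q \<times> carrier G)"
      using bij by (intro bij_betw_map_prod) auto
    then show "bij_betw p (Q \<times> carrier G) (Q \<times> carrier G)"
      by (rule bij_betw_cong[THEN iffD1, rotated]) (auto simp: p_def)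
  qed (auto simp: p_def split: if_splits)
  \<comment> \<open>The inverse is taken because functions on \<open>Q\<close> are pulled back:
    conjugation by \<open>x\<close> must turn \<open>\<theta>\<close> into its composite with
    \<open>shift\<close>.\<close>
  define x where "x = inv\<^bsub>H\<^esub> p"
  have x: "x \<in> carrier H" and inv_x: "inv\<^bsub>H\<^esub> x = p" using p by (simp_all add: x_def)
  have skewH: "skew G Q \<theta> \<in> carrier H" if "\<theta> \<in> Q \<rightarrow> carrier G" for \<theta>
    using G.skew_permutes[OF that] by (simp add: H_def)
  have conj: "x \<otimes>\<^bsub>H\<^esub> skew G Q \<theta> \<otimes>\<^bsub>H\<^esub> inv\<^bsub>H\<^esub> x = skew G Q (\<lambda>\<sigma>. \<theta> (shift \<sigma>))"
    if \<theta>: "\<theta> \<in> Q \<rightarrow> carrier G" for \<theta>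
  proof -
    have \<theta>': "(\<lambda>\<sigma>. \<theta> (shift \<sigma>)) \<in> Q \<rightarrow> carrier G" using \<theta> shiftQ by auto
    have "skew G Q \<theta> \<otimes>\<^bsub>H\<^esub> p = p \<otimes>\<^bsub>H\<^esub> skew G Q (\<lambda>\<sigma>. \<theta> (shift \<sigma>))"
      using \<theta> \<theta>' shiftQ by (auto simp: H_def skew_def p_def fun_eq_iff Pi_iff)
    then have "x \<otimes>\<^bsub>H\<^esub> (skew G Q \<theta> \<otimes>\<^bsub>H\<^esub> p) = skew G Q (\<lambda>\<sigma>. \<theta> (shift \<sigma>))"
      using p skewH[OF \<theta>'] by (simp only: x_def H.inv_solve_left' H.m_closed)
    then show ?thesis using x p skewH[OF \<theta>] by (simp only: inv_x H.m_assoc)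
  qed
  \<comment> \<open>Generators other than \<open>Gen_x\<close> act on the fibre over
    \<open>\<sigma>\<close> by their value under \<open>\<sigma>\<close>.\<close>
  define \<tau> where "\<tau> b = (case b of Gen_x \<Rightarrow> x | _ \<Rightarrow> skew G Q (\<lambda>\<sigma>. \<sigma> (letter_of b)))" for b
  have ev: "(\<lambda>\<sigma>. \<sigma> a) \<in> Q \<rightarrow> carrier G" if "a \<in> A" for a using Q that by auto
  show thesis
  proof (rule that[of \<tau>])
    show "\<tau> \<in> {Gen_x, Gen_y} \<union> Gen_z ` {1..d} \<rightarrow> carrier H"
    proof (rule Pi_I)
      fix b assume b: "b \<in> {Gen_x, Gen_y} \<union> Gen_z ` {1..d}"
      show "\<tau> b \<in> carrier H"
      proof (cases "b = Gen_x")
        case False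
        then have "letter_of b \<in> A" using b letter_u[of b] by (auto simp: A_def)
        from skewH[OF ev[OF this]] show ?thesis using False by (cases b) (simp_all add: \<tau>_def)
      qed (simp add: \<tau>_def x)
    qed
  next
    have yA: "None \<in> A" by (simp add: A_def)
    note y = skewH[OF ev[OF yA]]
    have U': "U \<in> Q \<rightarrow> carrier G" using U by auto
    have "word_val H \<tau> u = word_val H (\<lambda>b. skew G Q (\<lambda>\<sigma>. \<sigma> (letter_of b))) u"
      using u by (intro word_val_cong) (auto simp: \<tau>_def)
    also have "\<dots> = skew G Q U"
      unfolding H_def U_def[abs_def] using u letter_u ev by (intro G.skew_word_val) blast
    finally have uval: "word_val H \<tau> u = skew G Q U" .
    \<comment> \<open>Fibrewise the commutator is the shifted value of \<open>y\<close> times the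
      inverse of the old one, which is the inverse of the value of \<open>u\<close>.\<close>
    have "commutator H (\<tau> Gen_x) (\<tau> Gen_y) = skew G Q (\<lambda>\<sigma>. shift \<sigma> None) \<otimes>\<^bsub>H\<^esub> inv\<^bsub>H\<^esub> skew G Q (\<lambda>\<sigma>. \<sigma> None)"
      using conj[OF ev[OF yA]] by (simp add: commutator_def \<tau>_def)
    also have "\<dots> = skew G Q (\<lambda>\<sigma>. shift \<sigma> None) \<otimes>\<^bsub>H\<^esub> skew G Q (\<lambda>\<sigma>. inv\<^bsub>G\<^esub> \<sigma> None)"
      using G.inv_skew[OF ev[OF yA]] by (simp add: H_def)
    also have "\<dots> = skew G Q (\<lambda>\<sigma>. shift \<sigma> None \<otimes>\<^bsub>G\<^esub> inv\<^bsub>G\<^esub> \<sigma> None)"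
      using Q yA shiftQ by (simp add: H_def G.skew_mult)
    also have "\<dots> = skew G Q (\<lambda>\<sigma>. inv\<^bsub>G\<^esub> U \<sigma>)"
      using Q yA U by (intro skew_cong) (simp add: shift_None G.m_assoc)
    also have "\<dots> = inv\<^bsub>H\<^esub> skew G Q U"
      using G.inv_skew[OF U'] by (simp add: H_def)
    finally show "commutator H (\<tau> Gen_x) (\<tau> Gen_y) \<otimes>\<^bsub>H\<^esub> word_val H \<tau> u = \<one>\<^bsub>H\<^esub>"
      using H.l_inv[OF skewH[OF U']] by (simp only: uval)
  next
    fix a assume "a \<in> letters d UNIV"
    then consider "a = None" | j i where "j \<in> {1..d}" "a = Some (j, i)" by blast
    then show "letter_val H \<tau> a = skew G Q (\<lambda>\<sigma>. \<sigma> (map_option (apsnd (\<lambda>i. i mod N)) a))"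
    proof cases
      case 1
      then show ?thesis by (simp add: \<tau>_def)
    next
      case 2
      define t where "t i = skew G Q (\<lambda>\<sigma>. \<sigma> (Some (j, i mod N)))" for i
      have "x [^]\<^bsub>H\<^esub> i \<otimes>\<^bsub>H\<^esub> t 0 \<otimes>\<^bsub>H\<^esub> x [^]\<^bsub>H\<^esub> (- i) = t i"
      proof (rule H.conj_int_pow[OF x])
        show "t i \<in> carrier H" for i
          unfolding t_def by (intro skewH ev nextA 2)
        show "x \<otimes>\<^bsub>H\<^esub> t i \<otimes>\<^bsub>H\<^esub> inv\<^bsub>H\<^esub> x = t (i + 1)" for i
          unfolding t_def conj[OF ev[OF nextA[OF 2(1)]]] shift_Some[OF 2(1)] ..
      qed
      then show ?thesis by (simp add: 2 t_def \<tau>_def)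
    qed
  qed
qed

theorem lemma4p2:
  fixes d :: nat and u :: "gen_xyz word"
  assumes "u \<in> carrier (free_group (Gen_z ` {1..d}))"
  shows "let A = {Gen_x, Gen_y} \<union> Gen_z ` {1..d};
             F = free_group A
         in potent (presented_group A
              {commutator F (free_gen Gen_x) (free_gen Gen_y) \<otimes>\<^bsub>F\<^esub> u})"
proof -
  define A where "A = {Gen_x, Gen_y} \<union> Gen_z ` {1..d}"
  define r where "r = commutator (free_group A) (free_gen Gen_x) (free_gen Gen_y) \<otimes>\<^bsub>free_group A\<^esub> u"
  define S where "S = presented_group A {r}"
  define \<gamma> where "\<gamma> = pres_gen A {r}"
  interpret F: group "free_group A" by (rule group_free_group)
  have uz: "fst ` set u \<subseteq> Gen_z ` {1..d}" and red_u: "reduced u"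
    using assms by (simp_all add: carrier_free_group)
  then have uA: "fst ` set u \<subseteq> A" and uF: "u \<in> carrier (free_group A)"
    by (auto simp: A_def carrier_free_group)
  have gens: "free_gen Gen_x \<in> carrier (free_group A)" "free_gen Gen_y \<in> carrier (free_group A)"
    by (auto simp: A_def intro: free_gen_carrier)
  have comm: "commutator (free_group A) (free_gen Gen_x) (free_gen Gen_y) \<in> carrier (free_group A)"
    using gens by (simp add: commutator_def)
  have R: "{r} \<subseteq> carrier (free_group A)"
    using comm uF by (simp add: r_def)
  interpret S: group S unfolding S_def by (rule group_presented_group[OF R])
  have \<gamma>: "\<gamma> \<in> A \<rightarrow> carrier S" using pres_gen_carrier[OF R] by (simp add: \<gamma>_def S_def)
  have word_r: "word_val H \<tau> r = commutator H (\<tau> Gen_x) (\<tau> Gen_y) \<otimes>\<^bsub>H\<^esub> word_val H \<tau> u"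
    if "group H" "\<tau> \<in> A \<rightarrow> carrier H" for H :: "('h, 'i) monoid_scheme" and \<tau>
  proof -
    interpret H: group H by fact
    interpret h: group_hom "free_group A" H "word_val H \<tau>"
      using that by (intro group_hom.intro group_hom_axioms.intro group_free_group H.word_val_hom)
    have "\<tau> Gen_x \<in> carrier H" "\<tau> Gen_y \<in> carrier H" using that(2) by (auto simp: A_def)
    then show ?thesis
      using gens comm uF by (simp add: r_def h.hom_commutator H.word_val_free_gen_letter)
  qed
  have relS: "commutator S (\<gamma> Gen_x) (\<gamma> Gen_y) \<otimes>\<^bsub>S\<^esub> word_val S \<gamma> u = \<one>\<^bsub>S\<^esub>"
    using word_r[OF S.group_axioms \<gamma>] presented_group_relator[OF R, of r] by (simp add: S_def \<gamma>_def)
  \<comment> \<open>Applied below to a cyclic group and to a permutation group.\<close>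
  have hom_S: thesis
    if "group H" "\<tau> \<in> A \<rightarrow> carrier H"
      "commutator H (\<tau> Gen_x) (\<tau> Gen_y) \<otimes>\<^bsub>H\<^esub> word_val H \<tau> u = \<one>\<^bsub>H\<^esub>"
      "\<And>h. group_hom S H h \<Longrightarrow> (\<And>a. a \<in> A \<Longrightarrow> h (\<gamma> a) = \<tau> a) \<Longrightarrow> thesis"
    for H :: "('h, 'i) monoid_scheme" and \<tau> and thesis
    using presented_group_hom[OF R that(1,2)] word_r[OF that(1,2)] that(3,4)
    unfolding S_def \<gamma>_def by (metis singletonD)
  have letter_hom: "h (letter_val S \<gamma> a) = letter_val H \<tau> a"
    if "group_hom S H h" "\<And>a. a \<in> A \<Longrightarrow> h (\<gamma> a) = \<tau> a" "a \<in> letters d UNIV"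
    for H :: "('h, 'i) monoid_scheme" and h \<tau> a
  proof -
    interpret h: group_hom S H h by fact
    from that(3) consider "a = None" | j i where "j \<in> {1..d}" "a = Some (j, i)" by blast
    then show ?thesis
    proof cases
      case 1
      then show ?thesis using that(2) by (simp add: A_def)
    next
      case 2
      have "\<gamma> Gen_x \<in> carrier S" "\<gamma> (Gen_z j) \<in> carrier S" using \<gamma> 2(1) by (auto simp: A_def)
      then show ?thesis using that(2) 2 by (simp add: A_def h.hom_int_pow)
    qed
  qed
  let ?\<beta> = "letter_val S \<gamma>" and ?\<Lambda> = "letters d UNIV"
  have \<beta>: "?\<beta> \<in> ?\<Lambda> \<rightarrow> carrier S" using \<gamma> by (auto simp: A_def Pi_iff)
  have "potent S"
    unfolding potent_def
  proof (intro conjI ballI allI impI)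
    show "group S" by (rule S.group_axioms)
    fix s and m :: nat assume s: "s \<in> carrier S - {\<one>\<^bsub>S\<^esub>}" and "2 \<le> m"
    then obtain w where "fst ` set w \<subseteq> A" "s = word_val S \<gamma> w"
      using presented_group_cases[OF R, of s] by (auto simp: S_def \<gamma>_def)
    with S.word_normal_form[of \<gamma> d u w] \<gamma> uz relS
    obtain v k where v: "v \<in> carrier (free_group ?\<Lambda>)" and sv: "s = word_val S ?\<beta> v \<otimes>\<^bsub>S\<^esub> \<gamma> Gen_x [^]\<^bsub>S\<^esub> (k::int)"
      unfolding A_def by blast
    have v\<Lambda>: "fst ` set v \<subseteq> ?\<Lambda>" and red_v: "reduced v" using v by (simp_all add: carrier_free_group)
    have xS: "\<gamma> Gen_x \<in> carrier S" using \<gamma> by (auto simp: A_def)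
    have vS: "word_val S ?\<beta> v \<in> carrier S" by (rule S.word_val_closed[OF \<beta> v\<Lambda>])
    show "\<exists>(H :: nat monoid) h. group H \<and> finite (carrier H) \<and> h \<in> hom S H \<and> group.ord H (h s) = m"
    proof (cases "k = 0")
      case False
      \<comment> \<open>Modulo \<open>m * \<bar>k\<bar>\<close> the residue of \<open>k\<close> has
        order exactly \<open>m\<close>.\<close>
      define n where "n = m * nat \<bar>k\<bar>"
      define H where "H = integer_mod_group n"
      define \<tau> where "\<tau> b = (if b = Gen_x then 1 else 0 :: int)" for b
      have "2 \<le> n" using False \<open>2 \<le> m\<close> mult_le_mono[of 2 m 1 "nat \<bar>k\<bar>"] by (simp add: n_def)
      interpret H: group H by (simp add: H_def)
      interpret H: comm_group H by (simp add: H_def)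
      have \<tau>: "\<tau> \<in> A \<rightarrow> carrier H" using \<open>2 \<le> n\<close> by (auto simp: \<tau>_def H_def)
      have one: "word_val H \<rho> w = \<one>\<^bsub>H\<^esub>" if "\<And>a. a \<in> fst ` set w \<Longrightarrow> \<rho> a = \<one>\<^bsub>H\<^esub>" for \<rho> :: "'l \<Rightarrow> int" and w
        using that by (induction w) auto
      have "word_val H \<tau> u = \<one>\<^bsub>H\<^esub>"
        using uz by (intro one) (auto simp: \<tau>_def H_def)
      moreover have "\<tau> Gen_x \<in> carrier H" "\<tau> Gen_y = \<one>\<^bsub>H\<^esub>"
        using \<tau> by (auto simp: A_def H_def \<tau>_def)
      ultimately have "commutator H (\<tau> Gen_x) (\<tau> Gen_y) \<otimes>\<^bsub>H\<^esub> word_val H \<tau> u = \<one>\<^bsub>H\<^esub>"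
        by (simp add: commutator_def)
      from hom_S[OF H.group_axioms \<tau> this]
      obtain h where h: "group_hom S H h" "\<And>a. a \<in> A \<Longrightarrow> h (\<gamma> a) = \<tau> a" by blast
      interpret h: group_hom S H h by fact
      have "h (word_val S ?\<beta> v) = word_val H (h \<circ> ?\<beta>) v" by (rule h.hom_word_val[OF \<beta> v\<Lambda>])
      also have "\<dots> = \<one>\<^bsub>H\<^esub>"
      proof (rule one)
        fix a assume "a \<in> fst ` set v"
        with v\<Lambda> have "a \<in> ?\<Lambda>" by (rule subsetD)
        then have "(h \<circ> ?\<beta>) a = letter_val H \<tau> a" using letter_hom[OF h] by simp
        also have "\<dots> = \<one>\<^bsub>H\<^esub>"
          by (cases a) (auto simp: \<tau>_def H_def int_pow_integer_mod_group mod_simps)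
        finally show "(h \<circ> ?\<beta>) a = \<one>\<^bsub>H\<^esub>" .
      qed
      finally have "h s = \<tau> Gen_x [^]\<^bsub>H\<^esub> k"
        using vS xS h.hom_closed[OF xS] h(2)[of Gen_x] by (simp add: sv h.hom_int_pow A_def)
      then have hs: "h s = k mod int n" by (simp add: H_def \<tau>_def int_pow_integer_mod_group)
      have "group.ord H (h s) = m"
      proof (rule H.ord_eqI)
        show "h s \<in> carrier H" using s by simp
        fix i :: nat
        have "h s [^]\<^bsub>H\<^esub> i = \<one>\<^bsub>H\<^esub> \<longleftrightarrow> int n dvd int i * k"
          using \<open>h s \<in> carrier H\<close> by (simp add: H_def hs mod_simps dvd_eq_mod_eq_0)
        also have "\<dots> \<longleftrightarrow> int m * \<bar>k\<bar> dvd int i * \<bar>k\<bar>"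
        proof -
          have "int n = int m * \<bar>k\<bar>" "int i * \<bar>k\<bar> = \<bar>int i * k\<bar>"
            by (simp_all add: n_def abs_mult)
          then show ?thesis by (simp only: dvd_abs_iff)
        qed
        also have "\<dots> \<longleftrightarrow> m dvd i" using False by simp
        finally show "h s [^]\<^bsub>H\<^esub> i = \<one>\<^bsub>H\<^esub> \<longleftrightarrow> m dvd i" .
      qed
      moreover have "finite (carrier H)"
        using \<open>2 \<le> n\<close> by (simp add: H_def carrier_integer_mod_group)
      ultimately show ?thesis
        using finite_quotient_in_nat[OF H.group_axioms _ h.homh, of s] s by auto
    next
      case True
      then have sv: "s = word_val S ?\<beta> v" using sv vS by simp
      then have "v \<noteq> []" using s by auto
      define I where "I = {i. \<exists>j. Some (j, i) \<in> fst ` set v}"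
      \<comment> \<open>Two indices occurring in \<open>v\<close> differ by less than
        \<open>N\<close>, so they stay distinct modulo \<open>N\<close>. The summand 1 makes the
        bound strict and \<open>N\<close> positive.\<close>
      define N where "N = 2 * (\<Sum>i\<in>I. \<bar>i\<bar>) + 1"
      define \<rho> where "\<rho> = map_option (apsnd (\<lambda>i. i mod N) :: nat \<times> int \<Rightarrow> _)"
      have "I \<subseteq> (\<lambda>a. snd (the a)) ` fst ` set v"
      proof
        fix i assume "i \<in> I"
        then obtain j where "Some (j, i) \<in> fst ` set v" by (auto simp only: I_def mem_Collect_eq)
        then show "i \<in> (\<lambda>a. snd (the a)) ` fst ` set v"
          by (rule image_eqI[rotated]) simp
      qed
      then have "finite I" by (rule finite_subset) simp
      have I: "2 * \<bar>i\<bar> < N" if "i \<in> I" for i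
        using member_le_sum[OF that _ \<open>finite I\<close>, of abs] by (simp add: N_def)
      have "0 < N" by (simp add: N_def sum_nonneg add_nonneg_pos)
      have mod_inj: "i = i'" if "i \<in> I" "i' \<in> I" "i mod N = i' mod N" for i i'
      proof (rule ccontr)
        assume "i \<noteq> i'"
        have "N dvd i - i'" using that(3) by (simp add: mod_eq_dvd_iff)
        then have "\<bar>N\<bar> \<le> \<bar>i - i'\<bar>" using \<open>i \<noteq> i'\<close> by (intro dvd_imp_le_int) simp_all
        then show False using I[OF that(1)] I[OF that(2)] by linarith
      qed
      have "inj_on \<rho> (fst ` set v)"
      proof (rule inj_onI)
        fix a b assume ab: "a \<in> fst ` set v" "b \<in> fst ` set v" "\<rho> a = \<rho> b"
        show "a = b"
        proof (cases a)
          case (Some p)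
          then obtain j i where a: "a = Some (j, i)" by (cases p) auto
          with ab(3) obtain i' where b: "b = Some (j, i')" "i mod N = i' mod N"
            by (cases b) (auto simp: \<rho>_def)
          have "i \<in> I" "i' \<in> I" using ab(1,2) a b(1) by (auto simp: I_def)
          then show ?thesis using mod_inj b a by simp
        qed (use ab(3) in \<open>simp add: \<rho>_def\<close>)
      qed
      then have red: "reduced (map (apfst \<rho>) v)" using red_v by (rule reduced_map_apfst)
      define B where "B = letters d {0..<N}"
      have "finite B" by (simp add: B_def)
      have \<rho>B: "\<rho> a \<in> B" if "a \<in> ?\<Lambda>" for a
        using that \<open>0 < N\<close> by (auto simp: \<rho>_def B_def)
      have vB: "fst ` set (map (apfst \<rho>) v) \<subseteq> B"
        using v\<Lambda> \<rho>B by (auto simp: image_subset_iff)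
      have "map (apfst \<rho>) v \<noteq> []" "0 < m" using \<open>v \<noteq> []\<close> \<open>2 \<le> m\<close> by auto
      from finite_group_with_word_order[OF \<open>finite B\<close> vB this(1) red this(2)]
      obtain G :: "letter ncseries set monoid" and g where
        G: "group G" "finite (carrier G)" and g: "g \<in> B \<rightarrow> carrier G"
        and ord: "group.ord G (word_val G g (map (apfst \<rho>) v)) = m"
        and inv: "\<forall>\<sigma>\<in>B \<rightarrow> carrier G.
          word_val G \<sigma> (map (apfst \<rho>) v) [^]\<^bsub>G\<^esub> m = \<one>\<^bsub>G\<^esub>" .
      interpret G: group G by fact
      define Q where "Q = B \<rightarrow>\<^sub>E carrier G"
      define H where "H = perm_group (Q \<times> carrier G)"
      obtain \<tau> where \<tau>: "\<tau> \<in> A \<rightarrow> carrier H"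
        and rel: "commutator H (\<tau> Gen_x) (\<tau> Gen_y) \<otimes>\<^bsub>H\<^esub> word_val H \<tau> u = \<one>\<^bsub>H\<^esub>"
        and \<tau>_letter: "\<And>a. a \<in> ?\<Lambda> \<Longrightarrow> letter_val H \<tau> a = skew G Q (\<lambda>\<sigma>. \<sigma> (\<rho> a))"
        using skew_quotient[OF G \<open>0 < N\<close> uz] unfolding A_def H_def Q_def B_def \<rho>_def by blast
      interpret H: group H unfolding H_def by (rule group_perm_group)
      from hom_S[OF H.group_axioms \<tau> rel]
      obtain h where h: "group_hom S H h" "\<And>a. a \<in> A \<Longrightarrow> h (\<gamma> a) = \<tau> a" by blast
      interpret h: group_hom S H h by fact
      \<comment> \<open>The image of \<open>s\<close> acts on the fibre over \<open>\<sigma>\<close>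
        by the value of the relabelled word there, so its order is governed by these values at all
        points of \<open>Q\<close>.\<close>
      define \<Theta> where "\<Theta> \<sigma> = word_val G \<sigma> (map (apfst \<rho>) v)" for \<sigma>
      have QB: "\<sigma> \<in> B \<rightarrow> carrier G" if "\<sigma> \<in> Q" for \<sigma> using that by (auto simp: Q_def)
      have \<Theta>: "\<Theta> \<in> Q \<rightarrow> carrier G"
        unfolding \<Theta>_def[abs_def] using G.word_val_closed[OF QB vB] by blast
      have "h s = word_val H (h \<circ> ?\<beta>) v" unfolding sv by (rule h.hom_word_val[OF \<beta> v\<Lambda>])
      also have "\<dots> = word_val H (\<lambda>a. skew G Q (\<lambda>\<sigma>. \<sigma> (\<rho> a))) v"
      proof (rule word_val_cong)
        fix a assume "a \<in> fst ` set v"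
        with v\<Lambda> have "a \<in> ?\<Lambda>" by (rule subsetD)
        then show "(h \<circ> ?\<beta>) a = skew G Q (\<lambda>\<sigma>. \<sigma> (\<rho> a))"
          using letter_hom[OF h] \<tau>_letter by simp
      qed
      also have "\<dots> = skew G Q (\<lambda>\<sigma>. word_val G (\<lambda>a. \<sigma> (\<rho> a)) v)"
        unfolding H_def
      proof (rule G.skew_word_val)
        fix a assume "a \<in> fst ` set v"
        with v\<Lambda> have "a \<in> ?\<Lambda>" by (rule subsetD)
        then have "\<rho> a \<in> B" by (rule \<rho>B)
        then show "(\<lambda>\<sigma>. \<sigma> (\<rho> a)) \<in> Q \<rightarrow> carrier G" using QB by blast
      qed
      also have "\<dots> = skew G Q \<Theta>" by (simp add: \<Theta>_def[abs_def] word_val_map comp_def)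
      finally have hs: "h s = skew G Q \<Theta>" .
      have "group.ord H (h s) = m"
      proof (rule H.ord_eqI)
        show "h s \<in> carrier H" using s by simp
        fix i :: nat
        have pow: "(\<lambda>\<sigma>. \<Theta> \<sigma> [^]\<^bsub>G\<^esub> i) \<in> Q \<rightarrow> carrier G" using \<Theta> by auto
        have "h s [^]\<^bsub>H\<^esub> i = skew G Q (\<lambda>\<sigma>. \<Theta> \<sigma> [^]\<^bsub>G\<^esub> i)"
          unfolding hs H_def by (rule G.skew_pow[OF \<Theta>])
        then have "h s [^]\<^bsub>H\<^esub> i = \<one>\<^bsub>H\<^esub> \<longleftrightarrow> (\<forall>\<sigma>\<in>Q. \<Theta> \<sigma> [^]\<^bsub>G\<^esub> i = \<one>\<^bsub>G\<^esub>)"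
          using G.skew_eq_id_iff[OF pow] by (simp add: H_def)
        also have "\<dots> \<longleftrightarrow> m dvd i"
        proof
          assume *: "\<forall>\<sigma>\<in>Q. \<Theta> \<sigma> [^]\<^bsub>G\<^esub> i = \<one>\<^bsub>G\<^esub>"
          \<comment> \<open>The assignment \<open>g\<close>, at which the word has order exactly
            \<open>m\<close>, is itself a point of \<open>Q\<close>, so the order cannot drop below
            \<open>m\<close>.\<close>
          have "restrict g B \<in> Q" using g by (simp add: Q_def)
          moreover have "\<Theta> (restrict g B) = word_val G g (map (apfst \<rho>) v)"
            unfolding \<Theta>_def using vB by (intro word_val_cong) auto
          ultimately have "word_val G g (map (apfst \<rho>) v) [^]\<^bsub>G\<^esub> i = \<one>\<^bsub>G\<^esub>"
            using * by metis
          then show "m dvd i"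
            using G.pow_eq_id[OF G.word_val_closed[OF g vB]] ord by simp
        next
          assume "m dvd i"
          show "\<forall>\<sigma>\<in>Q. \<Theta> \<sigma> [^]\<^bsub>G\<^esub> i = \<one>\<^bsub>G\<^esub>"
          proof
            fix \<sigma> assume \<sigma>: "\<sigma> \<in> Q"
            then have "\<Theta> \<sigma> \<in> carrier G" using \<Theta> by blast
            \<comment> \<open>At the other points the order divides \<open>m\<close> by the
              endomorphism invariance of the quotient.\<close>
            moreover have "\<Theta> \<sigma> [^]\<^bsub>G\<^esub> m = \<one>\<^bsub>G\<^esub>" unfolding \<Theta>_def by (rule inv[rule_format, OF QB[OF \<sigma>]])
            ultimately show "\<Theta> \<sigma> [^]\<^bsub>G\<^esub> i = \<one>\<^bsub>G\<^esub>"
              using \<open>m dvd i\<close> G.pow_eq_id dvd_trans by metis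
          qed
        qed
        finally show "h s [^]\<^bsub>H\<^esub> i = \<one>\<^bsub>H\<^esub> \<longleftrightarrow> m dvd i" .
      qed
      moreover have "finite (carrier H)"
        unfolding H_def Q_def using \<open>finite B\<close> G(2)
        by (intro finite_perm_group finite_cartesian_product finite_PiE) auto
      ultimately show ?thesis
        using finite_quotient_in_nat[OF H.group_axioms _ h.homh, of s] s by auto
    qed
  qed
  then show ?thesis
    by (simp add: S_def r_def A_def Let_def)
qed

end
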